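(* Let $G$ be a graph on $n$ vertices with walk matrix $W=W(G)$. Suppose $W$ is non-singular and its last invariant factor $d_n$ is square-free. If for every odd prime factor $p$ of $d_n$, \[ \deg \operatorname{sqrt} \Phi_p(G;x) = \operatorname{nullity}_p W, \] then $G$ is determined by its generalized spectrum (DGS).
   Context: All graphs are simple and undirected; $A=A(G)$ is the adjacency matrix, $e$ the all-ones vector, $J$ the all-ones matrix, and $\chi(M;x)=\det(xI-M)$. The walk matrix is $W(G)=[e,Ae,\dots,A^{n-1}e]$. For a non-singular integer matrix $M$ of order $n$, its Smith normal form is $\operatorname{diag}(d_1,\dots,d_n)$ with positive integers $d_1\mid d_2\mid\cdots\mid d_n$ obtained as $UMV$ with $U,V$ unimodular; $d_n$ is the last invariant factor. An integer $b$ is square-free if $p^2\nmid b$ for every prime $p$. For a prime $p$, $\Phi_p(G;x)=\gcd(\chi(A;x),\chi(A+J;x))$, computed as a monic gcd in $\mathbb{F}_p[x]$. For a monic $f=\prod_i f_i^{e_i}\in\mathbb{F}_p[x]$ with distinct monic irreducible $f_i$, $\operatorname{sqrt}(f)=\prod_i f_i^{\lceil e_i/2\rceil}$. $\operatorname{nullity}_p M$ is the nullity of the integer matrix $M$ over $\mathbb{F}_p$. The generalized spectrum of $G$ is the pair (spectrum of $A(G)$, spectrum of $A(\overline{G})$), $\overline G$ the complement; $G$ is DGS if every graph with the same generalized spectrum is isomorphic to $G$. *)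

theory Defs
  imports
    "Graph_Theory.Graph_Theory"
    "Jordan_Normal_Form.Char_Poly"
    "Jordan_Normal_Form.Matrix_Kernel"
    "Berlekamp_Zassenhaus.Poly_Mod"
    "HOL-Computational_Algebra.Squarefree"
    "HOL-Number_Theory.Residues"
begin

text \<open>A graph is a symmetric loopless pair digraph; the vertices of a graph on \<open>n\<close> vertices are
  labelled \<open>0, \<dots>, n - 1\<close>, so that they index its matrices.\<close>

definition graph_on :: "nat \<Rightarrow> nat pair_pre_digraph \<Rightarrow> bool" where
  "graph_on n G \<longleftrightarrow> pair_graph G \<and> pverts G = {0..<n}"

definition graph_complement :: "'a pair_pre_digraph \<Rightarrow> 'a pair_pre_digraph" where
  "graph_complement G =
     \<lparr>pverts = pverts G,
      parcs = {(u, v). u \<in> pverts G \<and> v \<in> pverts G \<and> u \<noteq> v \<and> (u, v) \<notin> parcs G}\<rparr>"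

definition adjacency_matrix :: "nat \<Rightarrow> nat pair_pre_digraph \<Rightarrow> int mat" where
  "adjacency_matrix n G = mat n n (\<lambda>(i, j). if (i, j) \<in> parcs G then 1 else 0)"

definition all_ones_vec :: "nat \<Rightarrow> int vec" where
  "all_ones_vec n = vec n (\<lambda>_. 1)"

definition all_ones_mat :: "nat \<Rightarrow> int mat" where
  "all_ones_mat n = mat n n (\<lambda>_. 1)"

definition walk_matrix :: "nat \<Rightarrow> nat pair_pre_digraph \<Rightarrow> int mat" where
  "walk_matrix n G =
     mat_of_cols n (map (\<lambda>k. (adjacency_matrix n G ^\<^sub>m k) *\<^sub>v all_ones_vec n) [0..<n])"

text \<open>The spectrum is the multiset of eigenvalues, i.e. they count with multiplicity
  (unlike in \<open>Spectral_Radius.spectrum\<close>, which is a set).\<close>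

definition mat_spectrum :: "int mat \<Rightarrow> complex multiset" where
  "mat_spectrum M = proots (char_poly (map_mat of_int M))"

definition generalized_spectrum ::
    "nat \<Rightarrow> nat pair_pre_digraph \<Rightarrow> complex multiset \<times> complex multiset" where
  "generalized_spectrum n G =
     (mat_spectrum (adjacency_matrix n G),
      mat_spectrum (adjacency_matrix n (graph_complement G)))"

definition DGS :: "nat \<Rightarrow> nat pair_pre_digraph \<Rightarrow> bool" where
  "DGS n G \<longleftrightarrow>
     (\<forall>m H. graph_on m H \<and> generalized_spectrum m H = generalized_spectrum n G
        \<longrightarrow> digraph_iso (with_proj H) (with_proj G))"

definition smith_normal_form :: "int mat \<Rightarrow> int list \<Rightarrow> bool" where
  "smith_normal_form M ds \<longleftrightarrow>
     (let n = dim_row M in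
      M \<in> carrier_mat n n \<and> length ds = n \<and>
      (\<forall>i<n. ds ! i > 0) \<and> (\<forall>i. Suc i < n \<longrightarrow> ds ! i dvd ds ! Suc i) \<and>
      (\<exists>U V. U \<in> carrier_mat n n \<and> V \<in> carrier_mat n n \<and> \<bar>det U\<bar> = 1 \<and> \<bar>det V\<bar> = 1 \<and>
         U * M * V = mat_diag n (\<lambda>i. ds ! i)))"

text \<open>As the prime \<open>p\<close> varies inside the statement, \<open>F\<^sub>p\<close> cannot be a type. It is the ring
  \<open>residue_ring p\<close> on \<open>{0..<p}\<close>, and an element of \<open>F\<^sub>p[x]\<close> is the integer polynomial
  \<open>f\<close> with coefficients in \<open>{0..<p}\<close>, that is, with \<open>poly_mod.Mp p f = f\<close>.\<close>

definition kernel_mod :: "int \<Rightarrow> int mat \<Rightarrow> int vec set" where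
  "kernel_mod p M =
     {v \<in> carrier_vec (dim_col M).
        (\<forall>i<dim_col M. v $ i \<in> {0..<p}) \<and> (\<forall>i<dim_row M. (M *\<^sub>v v) $ i mod p = 0)}"

definition kernel_space_mod :: "int \<Rightarrow> int mat \<Rightarrow> (int, int vec) module" where
  "kernel_space_mod p M =
     \<lparr>carrier = kernel_mod p M, mult = undefined, one = undefined,
      zero = 0\<^sub>v (dim_col M),
      add = (\<lambda>v w. map_vec (\<lambda>a. a mod p) (v + w)),
      smult = (\<lambda>c v. map_vec (\<lambda>a. a mod p) (c \<cdot>\<^sub>v v))\<rparr>"

definition nullity_mod :: "int \<Rightarrow> int mat \<Rightarrow> nat" where
  "nullity_mod p M = vectorspace.dim (residue_ring p) (kernel_space_mod p M)"

text \<open>For prime \<open>p\<close> the description below determines exactly one \<open>h\<close>, unless \<open>f\<close> and \<open>g\<close> both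
  vanish modulo \<open>p\<close>, which cannot happen for characteristic polynomials.\<close>

definition gcd_mod :: "int \<Rightarrow> int poly \<Rightarrow> int poly \<Rightarrow> int poly" where
  "gcd_mod p f g =
     (THE h. poly_mod.Mp p h = h \<and> monic h \<and> poly_mod.dvdm p h f \<and> poly_mod.dvdm p h g \<and>
        (\<forall>k. poly_mod.dvdm p k f \<and> poly_mod.dvdm p k g \<longrightarrow> poly_mod.dvdm p k h))"

definition Phi_mod :: "int \<Rightarrow> nat \<Rightarrow> nat pair_pre_digraph \<Rightarrow> int poly" where
  "Phi_mod p n G =
     gcd_mod p (char_poly (adjacency_matrix n G))
               (char_poly (adjacency_matrix n G + all_ones_mat n))"

definition monic_irred_factors_mod :: "int \<Rightarrow> int poly \<Rightarrow> int poly set" where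
  "monic_irred_factors_mod p f =
     {h. poly_mod.Mp p h = h \<and> monic h \<and> poly_mod.irreducible_m p h \<and> poly_mod.dvdm p h f}"

definition multiplicity_mod :: "int \<Rightarrow> int poly \<Rightarrow> int poly \<Rightarrow> nat" where
  "multiplicity_mod p h f = (GREATEST e. poly_mod.dvdm p (h ^ e) f)"

definition sqrt_mod :: "int \<Rightarrow> int poly \<Rightarrow> int poly" where
  "sqrt_mod p f =
     poly_mod.Mp p (\<Prod>h\<in>monic_irred_factors_mod p f. h ^ nat \<lceil>real (multiplicity_mod p h f) / 2\<rceil>)"

end

theory Submission
  imports Defs
begin

text \<open>Let \<open>E = e\<^sup>T adj(xI - A) e = \<chi>(A) - \<chi>(A + J)\<close>, let \<open>M = W \<int>\<^sup>n\<close> be the lattice of walk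
  vectors and \<open>M\<^sup>*\<close> its dual. The module \<open>M\<^sup>*/M\<close> is cyclic, isomorphic to \<open>\<int>[x]/(\<chi>, E)\<close>. A generalized
  cospectral mate of \<open>G\<close> yields a rational orthogonal matrix \<open>Q\<close> with \<open>Q e = e\<close>, and both \<open>\<int>\<^sup>n\<close> and
  \<open>Q \<int>\<^sup>n\<close> are self-dual \<open>A\<close>-stable lattices between \<open>M\<close> and \<open>M\<^sup>*\<close>; hence in \<open>M\<^sup>*/M\<close> they become ideals
  of square zero. So an element \<open>f\<close> of either ideal satisfies \<open>\<Phi>\<^sub>p dvd f\<^sup>2\<close> modulo \<open>p\<close>, i.e.
  \<open>sqrt \<Phi>\<^sub>p dvd f\<close>. As \<open>p\<close> exactly divides \<open>d\<^sub>n\<close>, the ideal of \<open>\<int>\<^sup>n\<close> contains \<open>p\<close> and is generated modulo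
  \<open>p\<close> by a polynomial of degree \<open>nullity\<^sub>p W\<close>, which must be \<open>sqrt \<Phi>\<^sub>p\<close>; therefore \<open>Q \<int>\<^sup>n\<close> is contained
  in \<open>\<int>\<^sup>n\<close> locally at \<open>p\<close>. For \<open>p = 2\<close> no hypothesis is needed: parity shows that 2 annihilates
  \<open>M\<^sup>*/M\<close>, and this forces \<open>\<Phi>\<^sub>2\<close> to be the square of the generator. Once \<open>Q\<close> is integral it is a
  permutation matrix.\<close>

hide_const (open) up_ring.coeff up_ring.monom module.smult comm_monoid_mult_class.coprime

section \<open>Polynomials modulo a prime\<close>

text \<open>Scaling by \<open>d = last ds\<close> keeps everything integral: with \<open>w\<close>
  equal to \<open>d\<close> times the vector dual to the last walk vector,
  \<open>f \<mapsto> f(A) w\<close> identifies \<open>\<int>[x]/(\<chi>)\<close> with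
  \<open>d M\<^sup>*\<close>, and \<open>d M\<close> becomes the ideal of \<open>E\<close> because
  \<open>E(A) w = d e\<close>. The mate is seen only through the integer vectors
  \<open>u = d Q b\<close>: their pairings with the walk vectors are multiples of \<open>d\<close>,
  so \<open>u\<close> lies in \<open>d M\<^sup>*\<close>, and all
  \<open>u\<^sup>T A\<^sup>k u\<close> are multiples of \<open>d\<^sup>2\<close>. The goal is that
  \<open>d\<close> divides \<open>u\<close>, which square-freeness reduces to one prime at a time.
  The obstacle is that several square-zero ideals may coexist. Modulo \<open>p\<close> all of them
  lie in the ideal of \<open>sqrt \<Phi>\<^sub>p\<close>; the degree hypothesis makes the ideal of
  \<open>\<int>\<^sup>n\<close> equal to this largest one, so the ideal of
  \<open>Q \<int>\<^sup>n\<close> cannot escape it. Since \<open>p\<close> varies, the arguments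
  over the field with \<open>p\<close> elements are carried out for integer polynomials up to
  congruence.\<close>

lemma monic_divmod:
  assumes "monic (g :: int poly)"
  shows "\<exists>q r. f = g * q + r \<and> (r = 0 \<or> degree r < degree g)"
proof -
  obtain q r where qr: "pseudo_divmod f g = (q, r)" by fastforce
  have "g \<noteq> 0" using assms by auto
  from pseudo_divmod[OF this qr] assms show ?thesis by auto
qed

context poly_mod
begin

lemma eq_m_iff_dvd: "f =m g \<longleftrightarrow> (\<forall>i. m dvd coeff f i - coeff g i)"
  by (simp add: poly_eq_iff Mp_coeff M_def mod_eq_dvd_iff)

lemma eq_m_0_iff: "Mp f = 0 \<longleftrightarrow> (\<forall>i. m dvd coeff f i)"
  using eq_m_iff_dvd[of f 0] by simp

lemma eq_m_imp_add_smult: "f =m g \<Longrightarrow> \<exists>r. f = g + smult m r"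
proof -
  assume "f =m g"
  then have "\<forall>i. m dvd coeff (f - g) i" by (simp add: eq_m_iff_dvd)
  then have "[:m:] dvd f - g" by (simp add: const_poly_dvd_iff)
  then obtain r where "f - g = [:m:] * r" by (elim dvdE)
  then have "f = g + smult m r" by (simp add: algebra_simps)
  then show ?thesis ..
qed

lemma eq_m_add: "a =m b \<Longrightarrow> c =m d \<Longrightarrow> a + c =m b + d"
  using plus_Mp(1)[of a c] plus_Mp(2)[of "Mp a" c] plus_Mp(1)[of b d] plus_Mp(2)[of "Mp b" d]
  by simp

lemma eq_m_mult: "a =m b \<Longrightarrow> c =m d \<Longrightarrow> a * c =m b * d"
  using mult_Mp(1)[of a c] mult_Mp(2)[of "Mp a" c] mult_Mp(1)[of b d] mult_Mp(2)[of "Mp b" d]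
  by simp

lemma eq_m_diff: "a =m b \<Longrightarrow> c =m d \<Longrightarrow> a - c =m b - d"
  using minus_Mp(1)[of a c] minus_Mp(2)[of "Mp a" c] minus_Mp(1)[of b d] minus_Mp(2)[of "Mp b" d]
  by simp

lemma dvdmI: "b =m a * c \<Longrightarrow> a dvdm b"
  unfolding dvdm_def by (rule exI)

lemma dvdm_trans: "a dvdm b \<Longrightarrow> b dvdm c \<Longrightarrow> a dvdm c"
proof -
  assume "a dvdm b" "b dvdm c"
  then obtain h k where "b =m a * h" "c =m b * k" by (auto simp: dvdm_def)
  then have "c =m a * h * k" using eq_m_mult[of b "a * h" k k] by simp
  then show ?thesis by (intro dvdmI[of _ _ "h * k"]) (simp add: mult.assoc)
qed

lemma dvdm_refl: "a dvdm a"
  unfolding dvdm_def by (rule exI[of _ 1]) simp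

lemma dvdm_cong: "b =m c \<Longrightarrow> a dvdm b \<longleftrightarrow> a dvdm c"
  by (simp add: dvdm_def)

lemma dvd_imp_dvdm: "a dvd b \<Longrightarrow> a dvdm b"
  by (auto simp: dvdm_def dvd_def)

lemma dvdm_mult: "a dvdm b \<Longrightarrow> a dvdm c * b"
  using dvdm_trans[of a b "c * b"] dvd_imp_dvdm[of b "c * b"] by simp

lemma dvdm_mult2: "a dvdm b \<Longrightarrow> a dvdm b * c"
  using dvdm_mult[of a b c] by (simp add: mult.commute)

lemma dvdm_add: "a dvdm b \<Longrightarrow> a dvdm c \<Longrightarrow> a dvdm b + c"
proof -
  assume "a dvdm b" "a dvdm c"
  then obtain h k where "b =m a * h" "c =m a * k" by (auto simp: dvdm_def)
  from eq_m_add[OF this] show ?thesis by (intro dvdmI[of _ _ "h + k"]) (simp add: distrib_left)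
qed

lemma dvdm_diff: "a dvdm b \<Longrightarrow> a dvdm c \<Longrightarrow> a dvdm b - c"
proof -
  assume "a dvdm b" "a dvdm c"
  then obtain h k where "b =m a * h" "c =m a * k" by (auto simp: dvdm_def)
  from eq_m_diff[OF this] show ?thesis by (intro dvdmI[of _ _ "h - k"]) (simp add: right_diff_distrib)
qed

lemma mult_dvdm_mono: "a dvdm b \<Longrightarrow> c * a dvdm c * b"
proof -
  assume "a dvdm b"
  then obtain h where "b =m a * h" by (auto simp: dvdm_def)
  from eq_m_mult[OF refl this, of c] show ?thesis
    by (intro dvdmI[of _ _ h]) (simp add: mult.assoc)
qed

lemma dvdm_smult: "a dvdm b \<Longrightarrow> a dvdm smult c b"
  using dvdm_mult[of a b "[:c:]"] by simp

end

locale prime_poly_mod = poly_mod m for m +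
  assumes prime: "prime m"
begin

lemma m_gt_1: "1 < m" using prime by (simp add: prime_gt_1_int)

lemma M_bounds: "0 \<le> M x" "M x < m"
  using m_gt_1 by (auto simp: M_def)

lemma coeff_Mp_self: "Mp f = f \<Longrightarrow> 0 \<le> coeff f i \<and> coeff f i < m"
  using M_bounds[of "coeff f i"] Mp_coeff[of f i] by simp

lemma Mp_monic:
  assumes "monic f"
  shows "monic (Mp f)" "degree (Mp f) = degree f"
proof -
  have "coeff (Mp f) (degree f) = 1" using assms m_gt_1 by (simp add: Mp_coeff M_def)
  then have "degree f \<le> degree (Mp f)" by (intro le_degree) simp
  then show "degree (Mp f) = degree f" using degree_m_le[of f] by simp
  then show "monic (Mp f)" using \<open>coeff (Mp f) (degree f) = 1\<close> by simp
qed

text \<open>The leading coefficient of a nonzero reduced \<open>q\<close> lies strictly between 0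
  and \<open>m\<close>, and a monic factor does not change it, so reduction cannot lower the degree
  of the product.\<close>

lemma monic_mult_Mp:
  assumes "monic g" "Mp q = q" "q \<noteq> 0"
  shows "degree (Mp (g * q)) = degree g + degree q"
    and "lead_coeff (Mp (g * q)) = lead_coeff q"
proof -
  have "coeff (g * q) (degree g + degree q) = lead_coeff q"
    using assms(1) by (simp add: coeff_mult_degree_sum)
  moreover have "0 < lead_coeff q" "lead_coeff q < m"
    using coeff_Mp_self[OF assms(2), of "degree q"] assms(3) by (auto simp: le_less)
  ultimately have c: "coeff (Mp (g * q)) (degree g + degree q) = lead_coeff q"
    by (simp add: Mp_coeff M_def)
  moreover have "degree (Mp (g * q)) \<le> degree g + degree q"
    using degree_m_le[of "g * q"] degree_mult_le[of g q] by simp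
  ultimately show "degree (Mp (g * q)) = degree g + degree q"
    using assms(3) le_degree[of "Mp (g * q)" "degree g + degree q"] by simp
  then show "lead_coeff (Mp (g * q)) = lead_coeff q" using c by simp
qed

lemma monic_mult_eq_m_0:
  assumes "monic g" "Mp (g * q) = 0"
  shows "Mp q = 0"
proof (rule ccontr)
  assume *: "Mp q \<noteq> 0"
  have "lead_coeff (Mp (g * Mp q)) = lead_coeff (Mp q)"
    using monic_mult_Mp[OF assms(1) _ *] by simp
  then show False using assms(2) * by simp
qed

lemma monic_mult_cancel:
  assumes "monic g" "g * a =m g * b"
  shows "a =m b"
proof -
  have "Mp (g * (a - b)) = 0"
    using eq_m_diff[OF assms(2) refl, of "g * b"] by (simp add: right_diff_distrib)
  then have "Mp (a - b) = 0" by (rule monic_mult_eq_m_0[OF assms(1)])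
  then show ?thesis by (simp add: eq_m_iff_dvd eq_m_0_iff)
qed

lemma degree_monic_dvdm:
  assumes "monic g" "g dvdm f" "Mp f \<noteq> 0"
  shows "degree g \<le> degree_m f"
proof -
  obtain q where q: "f =m g * q" "Mp q = q" using assms(2) by (elim dvdmE)
  then have "q \<noteq> 0" using assms(3) by auto
  then show ?thesis using monic_mult_Mp(1)[OF assms(1) q(2)] q(1) by simp
qed

lemma monic_dvdm_antisym:
  assumes "Mp g = g" "monic g" "Mp h = h" "monic h" "g dvdm h" "h dvdm g"
  shows "g = h"
proof -
  obtain q where q: "h =m g * q" "Mp q = q" using assms(5) by (elim dvdmE)
  have g0: "g \<noteq> 0" "h \<noteq> 0" using assms(2,4) by auto
  then have "q \<noteq> 0" using q assms(3) by auto
  note d = monic_mult_Mp[OF assms(2) q(2) this]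
  have "degree h \<le> degree g" using degree_monic_dvdm[OF assms(4,6)] assms(1) g0 by simp
  then have "degree q = 0" using d(1) q(1) assms(3) by simp
  moreover have "lead_coeff q = 1" using d(2) q(1) assms(3,4) by simp
  ultimately have "q = 1" by (elim degree_eq_zeroE) simp
  then show ?thesis using q(1) assms(1,3) by simp
qed

lemma normalize_m:
  assumes "Mp f \<noteq> 0"
  shows "\<exists>c c'. M (c * c') = 1 \<and> monic (Mp (smult c f)) \<and> degree_m (smult c f) = degree_m f"
proof -
  let ?l = "lead_coeff (Mp f)"
  have "0 < ?l" "?l < m" using coeff_Mp_self[of "Mp f" "degree_m f"] assms by (auto simp: le_less)
  then have "coprime ?l m" using prime
    using prime_imp_coprime[of m ?l] zdvd_not_zless[of ?l m] by (auto simp: algebraic_semidom_class.coprime_commute)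
  then obtain c where "[?l * c = 1] (mod m)" using cong_solve_coprime_int[of ?l m] by auto
  then have c: "M (?l * c) = 1" using m_gt_1 by (simp add: cong_def M_def)
  have co: "coeff (Mp (smult c f)) (degree_m f) = 1"
  proof -
    have "coeff (Mp (smult c (Mp f))) (degree_m f) = M (c * ?l)"
      unfolding Mp_coeff by (simp add: Mp_coeff)
    then show ?thesis using c by (simp add: mult.commute)
  qed
  have "degree_m (smult c f) = degree_m f"
    using co degree_m_smult_le[of c f] le_degree[of "Mp (smult c f)" "degree_m f"] by simp
  with co have "monic (Mp (smult c f))" by simp
  then show ?thesis using c \<open>degree_m (smult c f) = degree_m f\<close>
    by (intro exI[of _ c] exI[of _ ?l]) (simp add: mult.commute)
qed

text \<open>A nonzero element of least degree in the ideal of \<open>a\<close> and \<open>b\<close>,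
  made monic, divides every element of the ideal, since the remainder of a division would have
  smaller degree. \<open>Mp a \<noteq> 0\<close> guarantees that a nonzero element exists.\<close>

lemma bezout_m:
  assumes "Mp a \<noteq> 0"
  shows "\<exists>g x y. Mp g = g \<and> monic g \<and> g dvdm a \<and> g dvdm b \<and> g =m x * a + y * b"
proof -
  let ?I = "{f. \<exists>x y. f =m x * a + y * b}"
  let ?P = "\<lambda>f. f \<in> ?I \<and> Mp f \<noteq> 0"
  have "a =m 1 * a + 0 * b" by simp
  then have "?P a" using assms by blast
  then obtain f where f: "?P f" and min: "\<And>f'. ?P f' \<Longrightarrow> degree_m f \<le> degree_m f'"
    using ex_has_least_nat[of ?P a degree_m] by blast
  obtain c c' where c: "monic (Mp (smult c f))" "degree_m (smult c f) = degree_m f"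
    using normalize_m[of f] f by blast
  let ?g = "Mp (smult c f)"
  obtain x y where xy: "f =m x * a + y * b" using f by blast
  have "smult c f =m smult c (x * a + y * b)" using xy Mp_smult(2)[of c f] Mp_smult(2)[of c "x * a + y * b"] by simp
  then have gI: "?g =m smult c x * a + smult c y * b" by (simp add: smult_add_right)
  have dv: "?g dvdm h" if h: "h =m x' * a + y' * b" for h x' y'
  proof -
    obtain q r where qr: "h = ?g * q + r" "r = 0 \<or> degree r < degree ?g"
      using monic_divmod[OF c(1), of h] by blast
    have "r =m h - ?g * q" using qr(1) by simp
    also have "Mp (h - ?g * q) = Mp ((x' * a + y' * b) - (smult c x * a + smult c y * b) * q)"
      by (intro eq_m_diff eq_m_mult h gI refl)
    finally have "r =m (x' - smult c x * q) * a + (y' - smult c y * q) * b"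
      by (simp add: algebra_simps)
    then have "r \<in> ?I" by blast
    moreover have "Mp r = 0 \<or> degree_m r < degree_m f"
      using qr(2) c(2) degree_m_le[of r] by auto
    ultimately have "Mp r = 0" using min[of r] by (meson linorder_not_le)
    then have "h =m ?g * q" using qr(1) eq_m_add[of "?g * q" "?g * q" r 0] by simp
    then show ?thesis by (rule dvdmI)
  qed
  show ?thesis
  proof (intro exI conjI)
    show "Mp ?g = ?g" by simp
    show "monic ?g" by (rule c(1))
    show "?g dvdm a" by (rule dv[of a 1 0]) simp
    show "?g dvdm b" by (rule dv[of b 0 1]) simp
    show "?g =m smult c x * a + smult c y * b" by (rule gI)
  qed
qed

lemma gcd_mod:
  assumes "Mp a \<noteq> 0"
  shows "Mp (gcd_mod m a b) = gcd_mod m a b" "monic (gcd_mod m a b)"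
    "gcd_mod m a b dvdm a" "gcd_mod m a b dvdm b"
proof -
  let ?P = "\<lambda>h. Mp h = h \<and> monic h \<and> h dvdm a \<and> h dvdm b \<and>
        (\<forall>k. k dvdm a \<and> k dvdm b \<longrightarrow> k dvdm h)"
  obtain g x y where g: "Mp g = g" "monic g" "g dvdm a" "g dvdm b" "g =m x * a + y * b"
    using bezout_m[OF assms] by blast
  have "k dvdm g" if "k dvdm a" "k dvdm b" for k
    using that dvdm_cong[OF g(5)] by (simp add: dvdm_add dvdm_mult)
  then have "?P g" using g by blast
  moreover have "h = g" if "?P h" for h
    using that \<open>?P g\<close> by (blast intro: monic_dvdm_antisym)
  ultimately have "?P (gcd_mod m a b)"
    unfolding gcd_mod_def by (rule theI[of ?P g])
  then show "Mp (gcd_mod m a b) = gcd_mod m a b" "monic (gcd_mod m a b)"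
    "gcd_mod m a b dvdm a" "gcd_mod m a b dvdm b" by auto
qed

section \<open>Irreducible factors and their multiplicities modulo a prime\<close>

lemma irreducible_m_dvdm_mult:
  assumes h: "irreducible_m h" "monic h" and ab: "h dvdm a * b"
  shows "h dvdm a \<or> h dvdm b"
proof (rule disjCI)
  assume nb: "\<not> h dvdm b"
  have "Mp h \<noteq> 0" using h(1) by (auto simp: irreducible_m_def)
  then obtain g x y where g: "g dvdm h" "g dvdm b" "g =m x * h + y * b"
    using bezout_m[of h b] by blast
  obtain k where k: "h =m g * k" using g(1) by (auto simp: dvdm_def)
  then have "g dvdm 1 \<or> k dvdm 1" using h(1) unfolding irreducible_m_def by blast
  then show "h dvdm a"
  proof
    assume "g dvdm 1"
    then obtain u where u: "1 =m g * u" by (auto simp: dvdm_def)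
    have "a =m a * (g * u)" using eq_m_mult[OF refl u, of a] by simp
    moreover have "a * (g * u) =m a * ((x * h + y * b) * u)" by (intro eq_m_mult g(3) refl)
    ultimately have "a =m (a * x * u) * h + (y * u) * (a * b)" by (simp add: algebra_simps)
    from dvdm_cong[OF this] show ?thesis
      using dvdm_add[OF dvdm_mult[OF dvdm_refl] dvdm_mult[OF ab]] by blast
  next
    assume "k dvdm 1"
    then obtain u where u: "1 =m k * u" by (auto simp: dvdm_def)
    have "g =m g * (k * u)" using eq_m_mult[OF refl u, of g] by simp
    moreover have "h * u =m g * (k * u)" using eq_m_mult[OF k refl, of u] by (simp add: mult.assoc)
    ultimately have "h dvdm g" by (intro dvdmI[of _ _ u]) simp
    then show ?thesis using nb dvdm_trans[of h g b] g(2) by blast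
  qed
qed

lemma irreducible_m_not_dvdm_1: "irreducible_m h \<Longrightarrow> \<not> h dvdm 1"
  by (simp add: irreducible_m_def)

lemma irreducible_m_degree:
  assumes "irreducible_m h" "monic h"
  shows "0 < degree h"
proof (rule ccontr)
  assume "\<not> 0 < degree h"
  then obtain a where "h = [:a:]" using degree_eq_zeroE[of h] by auto
  then have "h = 1" using assms(2) by simp
  then show False using assms(1) irreducible_m_not_dvdm_1[of 1] dvdm_refl by simp
qed

text \<open>The bound on \<open>c\<close> says that \<open>c\<close> is at most half of
  \<open>e\<close> rounded up, the exponent used by \<open>sqrt_mod\<close>. As long as
  \<open>2 * c + 1 \<le> e\<close>, cancelling \<open>h ^ (2 * c)\<close> from \<open>f ^ 2\<close>
  leaves \<open>h\<close> dividing the square of the cofactor of \<open>h ^ c\<close> in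
  \<open>f\<close>, hence the cofactor itself.\<close>

lemma power_dvdm_square:
  assumes h: "irreducible_m h" "monic h" and d: "h ^ e dvdm f ^ 2" and "2 * c \<le> e + 1"
  shows "h ^ c dvdm f"
  using \<open>2 * c \<le> e + 1\<close>
proof (induction c)
  case 0
  then show ?case by (simp add: dvd_imp_dvdm)
next
  case (Suc c)
  then obtain f' where f': "f =m h ^ c * f'" by (auto simp: dvdm_def)
  have "h ^ (2 * c) * h dvdm f ^ 2"
  proof (rule dvdm_trans[OF _ d])
    have "2 * c + 1 \<le> e" using Suc.prems by simp
    then show "h ^ (2 * c) * h dvdm h ^ e"
      using dvd_imp_dvdm[OF le_imp_power_dvd[of "2 * c + 1" e h]] by (simp add: mult.commute)
  qed
  moreover have "f ^ 2 =m h ^ (2 * c) * f' ^ 2"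
    using eq_m_mult[OF f' f'] by (simp add: power2_eq_square ac_simps power_add mult_2_right)
  ultimately have "h ^ (2 * c) * h dvdm h ^ (2 * c) * f' ^ 2" using dvdm_cong[of "f ^ 2"] by simp
  then obtain q where "h ^ (2 * c) * f' ^ 2 =m h ^ (2 * c) * (h * q)"
    by (auto simp: dvdm_def mult.assoc)
  then have "f' ^ 2 =m h * q" by (rule monic_mult_cancel[OF monic_power[OF h(2)]])
  then have "h dvdm f' * f'" by (auto simp: dvdm_def power2_eq_square)
  then have "h dvdm f'" using irreducible_m_dvdm_mult[OF h] by blast
  then have "h ^ c * h dvdm h ^ c * f'" by (rule mult_dvdm_mono)
  then show ?case using dvdm_cong[OF f'] by (simp add: mult.commute)
qed

lemma power_dvdm_of_coprime:
  assumes h: "irreducible_m h" "monic h" and "\<not> h dvdm b" "h ^ c dvdm b * q"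
  shows "h ^ c dvdm q"
  using assms(4)
proof (induction c)
  case 0
  then show ?case by (simp add: dvd_imp_dvdm)
next
  case (Suc c)
  have "h ^ c dvdm b * q"
    by (rule dvdm_trans[OF dvd_imp_dvdm Suc.prems]) simp
  then obtain q' where q': "q =m h ^ c * q'" using Suc.IH by (auto simp: dvdm_def)
  obtain r where "b * q =m h ^ Suc c * r" using Suc.prems by (auto simp: dvdm_def)
  then have "h ^ c * (b * q') =m h ^ c * (h * r)"
    using eq_m_mult[OF refl q', of b] by (simp add: algebra_simps)
  then have "b * q' =m h * r" by (rule monic_mult_cancel[OF monic_power[OF h(2)]])
  then have "h dvdm b * q'" by (auto simp: dvdm_def)
  then have "h dvdm q'" using irreducible_m_dvdm_mult[OF h] assms(3) by blast
  then have "h ^ c * h dvdm h ^ c * q'" by (rule mult_dvdm_mono)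
  then show ?case using dvdm_cong[OF q'] by (simp add: mult.commute)
qed

lemma irreducible_m_not_dvdm_prod:
  assumes "finite F" "irreducible_m h" "monic h" "Mp h = h" "h \<notin> F"
    and "\<And>k. k \<in> F \<Longrightarrow> irreducible_m k \<and> monic k \<and> Mp k = k"
  shows "\<not> h dvdm (\<Prod>k\<in>F. k ^ c k)"
  using assms(1,5,6)
proof (induction F rule: finite_induct)
  case empty
  then show ?case using assms(2) irreducible_m_not_dvdm_1 by simp
next
  case (insert k F)
  have k: "irreducible_m k" "monic k" "Mp k = k" using insert.prems by auto
  have "\<not> h dvdm k"
  proof
    assume hk: "h dvdm k"
    then obtain q where q: "k =m h * q" by (auto simp: dvdm_def)
    then have "q dvdm 1" using k(1) assms(2) unfolding irreducible_m_def by blast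
    then obtain u where u: "1 =m q * u" by (auto simp: dvdm_def)
    have "h =m h * (q * u)" using eq_m_mult[OF refl u, of h] by simp
    moreover have "k * u =m h * (q * u)" using eq_m_mult[OF q refl, of u] by (simp add: mult.assoc)
    ultimately have "k dvdm h" by (intro dvdmI[of _ _ u]) simp
    with hk k(2,3) assms(3,4) have "h = k" by (blast intro: monic_dvdm_antisym)
    then show False using insert.prems by auto
  qed
  have "\<not> h dvdm k ^ j" for j
  proof (induction j)
    case 0
    then show ?case using irreducible_m_not_dvdm_1[OF assms(2)] by simp
  next
    case (Suc j)
    then show ?case using \<open>\<not> h dvdm k\<close> irreducible_m_dvdm_mult[OF assms(2,3), of k "k ^ j"] by simp blast
  qed
  moreover have "\<not> h dvdm (\<Prod>k\<in>F. k ^ c k)" using insert by simp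
  ultimately have "\<not> h dvdm k ^ c k * (\<Prod>k\<in>F. k ^ c k)"
    using irreducible_m_dvdm_mult[OF assms(2,3)] by blast
  then show ?case using insert by simp
qed

lemma prod_powers_dvdm:
  assumes "finite F" and F: "\<And>k. k \<in> F \<Longrightarrow> irreducible_m k \<and> monic k \<and> Mp k = k"
    and "\<And>k. k \<in> F \<Longrightarrow> k ^ c k dvdm f"
  shows "(\<Prod>k\<in>F. k ^ c k) dvdm f"
  using assms
proof (induction F rule: finite_induct)
  case empty
  then show ?case by (simp add: dvd_imp_dvdm)
next
  case (insert k F)
  then obtain q where q: "f =m (\<Prod>k\<in>F. k ^ c k) * q" by (auto simp: dvdm_def)
  have "k ^ c k dvdm (\<Prod>k\<in>F. k ^ c k) * q" using insert.prems dvdm_cong[OF q] by simp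
  moreover have "\<not> k dvdm (\<Prod>k\<in>F. k ^ c k)"
    using insert by (intro irreducible_m_not_dvdm_prod) auto
  ultimately have "k ^ c k dvdm q"
    using power_dvdm_of_coprime[of k "\<Prod>k\<in>F. k ^ c k" "c k" q] insert.prems(1)[of k] by simp
  then have "(\<Prod>k\<in>F. k ^ c k) * k ^ c k dvdm (\<Prod>k\<in>F. k ^ c k) * q" by (rule mult_dvdm_mono)
  then show ?case using insert dvdm_cong[OF q] by (simp add: mult.commute)
qed

text \<open>\<open>GREATEST\<close> has its intended meaning only for a bounded property. Here the
  exponents are bounded by \<open>degree_m f\<close>, because \<open>h\<close> has positive
  degree.\<close>

lemma multiplicity_mod_dvdm:
  assumes h: "irreducible_m h" "monic h" and f: "Mp f \<noteq> 0"
  shows "h ^ multiplicity_mod m h f dvdm f"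
  unfolding multiplicity_mod_def
proof (rule GreatestI_nat[of _ 0])
  show "h ^ 0 dvdm f" by (simp add: dvd_imp_dvdm)
  fix e assume "h ^ e dvdm f"
  then have "degree (h ^ e) \<le> degree_m f"
    by (intro degree_monic_dvdm monic_power h(2) f)
  moreover have "degree (h ^ e) = e * degree h"
    using h(2) by (intro Polynomial.degree_power_eq) auto
  moreover have "e * 1 \<le> e * degree h"
    using irreducible_m_degree[OF h] by (intro mult_le_mono) auto
  ultimately show "e \<le> degree_m f" by linarith
qed

lemma monic_sqrt_mod: "monic (sqrt_mod m f)"
  unfolding sqrt_mod_def
  by (intro Mp_monic(1) monic_prod monic_power) (auto simp: monic_irred_factors_mod_def)

lemma sqrt_mod_dvdm:
  assumes "monic f" "f dvdm g ^ 2"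
  shows "sqrt_mod m f dvdm g"
proof -
  let ?F = "monic_irred_factors_mod m f"
  let ?c = "\<lambda>h. nat \<lceil>real (multiplicity_mod m h f) / 2\<rceil>"
  have f0: "Mp f \<noteq> 0" using Mp_monic(1)[OF assms(1)] by auto
  have "(\<Prod>h\<in>?F. h ^ ?c h) dvdm g"
  proof (cases "finite ?F")
    case True
    then show ?thesis
    proof (rule prod_powers_dvdm)
      fix h assume "h \<in> ?F"
      then have h: "irreducible_m h" "monic h" "Mp h = h" "h dvdm f"
        by (auto simp: monic_irred_factors_mod_def)
      then show "irreducible_m h \<and> monic h \<and> Mp h = h" by simp
      have "h ^ multiplicity_mod m h f dvdm g ^ 2"
        using multiplicity_mod_dvdm[OF h(1,2) f0] assms(2) by (rule dvdm_trans)
      moreover have "2 * ?c h \<le> multiplicity_mod m h f + 1" by linarith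
      ultimately show "h ^ ?c h dvdm g" by (rule power_dvdm_square[OF h(1,2)])
    qed
  next
    \<comment> \<open>A product over an infinite set is 1 by convention, and 1 divides
      everything.\<close>
    case False
    then show ?thesis by (simp add: dvd_imp_dvdm)
  qed
  then show ?thesis by (simp add: sqrt_mod_def)
qed

end

section \<open>Polynomials in a matrix acting on vectors\<close>

lemma smult_mult_mat_vec:
  assumes "(A :: 'a :: comm_ring_1 mat) \<in> carrier_mat nr nc" "v \<in> carrier_vec nc"
  shows "A *\<^sub>v (c \<cdot>\<^sub>v v) = c \<cdot>\<^sub>v (A *\<^sub>v v)"
  using assms by (intro eq_vecI) auto

lemma vec_eq_if_scalar_prod_eq:
  assumes "u \<in> carrier_vec n" "v \<in> carrier_vec n"
    and "\<And>x. x \<in> carrier_vec n \<Longrightarrow> x \<bullet> u = x \<bullet> (v :: 'a :: comm_ring_1 vec)"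
  shows "u = v"
proof (rule eq_vecI)
  fix i assume i: "i < dim_vec v"
  then have "unit_vec n i \<bullet> u = unit_vec n i \<bullet> v" using assms(2,3) by auto
  then show "u $ i = v $ i" using i assms(1,2) by simp
qed (use assms in auto)

text \<open>This is \<open>f(A) v\<close>, evaluated by Horner's scheme on vectors, so that no
  matrix polynomial has to be formed.\<close>

definition mat_poly_act :: "'a :: comm_ring_1 mat \<Rightarrow> 'a poly \<Rightarrow> 'a vec \<Rightarrow> 'a vec" where
  "mat_poly_act A f v = fold_coeffs (\<lambda>a x. a \<cdot>\<^sub>v v + A *\<^sub>v x) f (0\<^sub>v (dim_vec v))"

locale square_mat =
  fixes A :: "'a :: comm_ring_1 mat" and n :: nat
  assumes A: "A \<in> carrier_mat n n"
begin

lemma dim_A [simp]: "dim_row A = n" "dim_col A = n"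
  using carrier_matD[OF A] by auto

lemma mult_A_closed [simp, intro]: "A *\<^sub>v v \<in> carrier_vec n"
  by (auto intro: carrier_vecI)

abbreviation act :: "'a poly \<Rightarrow> 'a vec \<Rightarrow> 'a vec" where
  "act \<equiv> mat_poly_act A"

lemma act_0: "v \<in> carrier_vec n \<Longrightarrow> act 0 v = 0\<^sub>v n"
  by (auto simp: mat_poly_act_def)

lemma act_pCons:
  assumes "v \<in> carrier_vec n"
  shows "act (pCons a f) v = a \<cdot>\<^sub>v v + A *\<^sub>v act f v"
proof (cases "a = 0 \<and> f = 0")
  case True
  then have "act (pCons a f) v = 0\<^sub>v n" "act f v = 0\<^sub>v n" using act_0[OF assms] by auto
  then show ?thesis using True assms by (auto simp: scalar_prod_def intro!: eq_vecI)
next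
  case False
  then show ?thesis
    by (cases "a = 0") (auto simp: mat_poly_act_def fold_coeffs_pCons_coeff_not_0_eq fold_coeffs_pCons_not_0_0_eq)
qed

lemma act_closed [simp, intro]: "v \<in> carrier_vec n \<Longrightarrow> act f v \<in> carrier_vec n"
  by (induction f) (auto simp: act_0 act_pCons)

lemma dim_act [simp]: "v \<in> carrier_vec n \<Longrightarrow> dim_vec (act f v) = n"
  using act_closed carrier_vecD by blast

lemma act_add:
  assumes v: "v \<in> carrier_vec n"
  shows "act (f + g) v = act f v + act g v"
proof (induction f arbitrary: g)
  case 0
  then show ?case using v by (simp add: act_0)
next
  case (pCons a f)
  obtain b g' where g: "g = pCons b g'" by (cases g)
  have "act (pCons a f + g) v = (a + b) \<cdot>\<^sub>v v + A *\<^sub>v (act f v + act g' v)"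
    using v pCons.IH by (simp add: g act_pCons)
  also have "\<dots> = (a \<cdot>\<^sub>v v + b \<cdot>\<^sub>v v) + (A *\<^sub>v act f v + A *\<^sub>v act g' v)"
    using v by (simp add: add_smult_distrib_vec mult_add_distrib_mat_vec[OF A])
  also have "\<dots> = (a \<cdot>\<^sub>v v + A *\<^sub>v act f v) + (b \<cdot>\<^sub>v v + A *\<^sub>v act g' v)"
    using v by (intro eq_vecI) (auto simp: algebra_simps)
  finally show ?case using v by (simp add: g act_pCons)
qed

lemma act_smult:
  assumes v: "v \<in> carrier_vec n"
  shows "act (smult c f) v = c \<cdot>\<^sub>v act f v"
proof (induction f)
  case 0
  then show ?case using v by (auto simp: act_0 intro!: eq_vecI)
next
  case (pCons a f)
  then show ?case using v
    by (simp add: act_pCons smult_add_distrib_vec[of _ n] smult_mult_mat_vec[OF A] smult_smult_assoc)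
qed

lemma act_diff:
  assumes v: "v \<in> carrier_vec n"
  shows "act (f - g) v = act f v - act g v"
proof -
  have "act (f - g) v = act (f + smult (-1) g) v" by simp
  also have "\<dots> = act f v + (-1) \<cdot>\<^sub>v act g v" using v by (simp only: act_add act_smult)
  also have "\<dots> = act f v - act g v" using v by (intro eq_vecI) auto
  finally show ?thesis .
qed

lemma act_pCons_0: "v \<in> carrier_vec n \<Longrightarrow> act (pCons 0 f) v = A *\<^sub>v act f v"
  by (auto simp: act_pCons intro!: eq_vecI)

lemma act_mult:
  assumes v: "v \<in> carrier_vec n"
  shows "act (f * g) v = act f (act g v)"
proof (induction f)
  case 0
  then show ?case using v by (simp add: act_0)
next
  case (pCons a f)
  have "act (pCons a f * g) v = a \<cdot>\<^sub>v act g v + A *\<^sub>v act f (act g v)"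
    using v pCons.IH by (simp add: act_add act_smult act_pCons_0)
  then show ?case using act_pCons[OF act_closed[OF v]] by simp
qed

lemma act_1: "v \<in> carrier_vec n \<Longrightarrow> act 1 v = v"
  using act_pCons[of v 1 0] by (auto simp: act_0 scalar_prod_def intro!: eq_vecI)

lemma act_commute: "v \<in> carrier_vec n \<Longrightarrow> act f (act g v) = act g (act f v)"
proof -
  assume v: "v \<in> carrier_vec n"
  have "act f (act g v) = act (f * g) v" by (rule act_mult[OF v, symmetric])
  also have "f * g = g * f" by (rule mult.commute)
  also have "act (g * f) v = act g (act f v)" by (rule act_mult[OF v])
  finally show ?thesis .
qed

lemma act_vec_smult:
  assumes "v \<in> carrier_vec n"
  shows "act f (c \<cdot>\<^sub>v v) = c \<cdot>\<^sub>v act f v"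
proof -
  have "act [:c:] u = c \<cdot>\<^sub>v u" if "u \<in> carrier_vec n" for u
    using that act_smult[of u c 1] by (simp add: act_1)
  then have "act f (c \<cdot>\<^sub>v v) = act f (act [:c:] v)" "act [:c:] (act f v) = c \<cdot>\<^sub>v act f v"
    using assms by simp_all
  then show ?thesis using act_commute[OF assms] by simp
qed

lemma act_monom: "v \<in> carrier_vec n \<Longrightarrow> act (monom 1 k) v = (A ^\<^sub>m k) *\<^sub>v v"
proof (induction k arbitrary: v)
  case 0
  then show ?case by (simp add: act_1 monom_0 flip: one_pCons)
next
  case (Suc k)
  have "act (monom 1 (Suc k)) v = act (monom 1 k * pCons 0 1) v" by (simp add: monom_Suc)
  also have "\<dots> = act (monom 1 k) (A *\<^sub>v v)"
    unfolding act_mult[OF Suc.prems] using Suc.prems by (simp add: act_pCons_0 act_1)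
  also have "\<dots> = (A ^\<^sub>m k) *\<^sub>v (A *\<^sub>v v)" by (rule Suc.IH) simp
  also have "\<dots> = (A ^\<^sub>m Suc k) *\<^sub>v v" using Suc.prems A by (simp add: assoc_mult_mat_vec[of _ n n _ n])
  finally show ?case .
qed

lemma act_scalar_prod_sum:
  assumes "u \<in> carrier_vec n" "v \<in> carrier_vec n" "\<And>i. N \<le> i \<Longrightarrow> coeff f i = 0"
  shows "act f u \<bullet> v = (\<Sum>i<N. coeff f i * (act (monom 1 i) u \<bullet> v))"
  using assms(3)
proof (induction N arbitrary: f)
  case 0
  then have "f = 0" by (simp add: poly_eq_iff)
  then show ?case using assms(1,2) by (simp add: act_0)
next
  case (Suc N)
  let ?g = "f - monom (coeff f N) N"
  have "coeff ?g i = 0" if "N \<le> i" for i using Suc.prems that by (cases "i = N") auto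
  then have "act ?g u \<bullet> v = (\<Sum>i<N. coeff ?g i * (act (monom 1 i) u \<bullet> v))" by (rule Suc.IH)
  also have "\<dots> = (\<Sum>i<N. coeff f i * (act (monom 1 i) u \<bullet> v))" by (intro sum.cong) auto
  finally have g: "act ?g u \<bullet> v = (\<Sum>i<N. coeff f i * (act (monom 1 i) u \<bullet> v))" .
  have "f = ?g + smult (coeff f N) (monom 1 N)" by (simp add: smult_monom)
  then have "act f u = act ?g u + coeff f N \<cdot>\<^sub>v act (monom 1 N) u"
    using assms(1) act_add act_smult by metis
  then have "act f u \<bullet> v = act ?g u \<bullet> v + coeff f N * (act (monom 1 N) u \<bullet> v)"
    using assms(1,2) by (simp add: add_scalar_prod_distrib[of _ n])
  then show ?case by (simp add: g)
qed

text \<open>The coefficient vectors of the solution \<open>adj (xI - A) v\<close> of \<open>(xI - A) z = \<chi> v\<close> satisfy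
  Horner's recursion for \<open>\<chi>\<close>, so they are its Horner shifts applied to \<open>v\<close>.\<close>

lemma adj_char_poly_matrix:
  assumes v: "v \<in> carrier_vec n"
  obtains z where "z \<in> carrier_vec n"
    and "char_poly_matrix A *\<^sub>v z = char_poly A \<cdot>\<^sub>v map_vec (\<lambda>a. [:a:]) v"
    and "\<And>j r. r < n \<Longrightarrow> coeff (z $ r) j = act (poly_shift (Suc j) (char_poly A)) v $ r"
    and "act (char_poly A) v = 0\<^sub>v n"
proof -
  let ?C = "char_poly_matrix A" and ?\<chi> = "char_poly A" and ?v = "map_vec (\<lambda>a. [:a:]) v"
  define z where "z = adj_mat ?C *\<^sub>v ?v"
  have C: "?C \<in> carrier_mat n n" using A by (rule char_poly_matrix_closed)
  have Cd: "dim_row ?C = n" "dim_col ?C = n" using carrier_matD[OF C] by auto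
  have z: "z \<in> carrier_vec n" using v adj_mat(1)[OF C] by (simp add: z_def)
  have Cz: "?C *\<^sub>v z = ?\<chi> \<cdot>\<^sub>v ?v"
  proof -
    have "?C *\<^sub>v z = (?C * adj_mat ?C) *\<^sub>v ?v"
      unfolding z_def using v by (intro assoc_mult_mat_vec[OF C adj_mat(1)[OF C], symmetric]) simp
    also have "\<dots> = ?\<chi> \<cdot>\<^sub>v ?v"
      using v by (auto simp: adj_mat(2)[OF C] char_poly_def intro!: eq_vecI)
    finally show ?thesis .
  qed
  \<comment> \<open>\<open>Z j\<close> collects the coefficients of \<open>x ^ (j - 1)\<close> in
    \<open>z\<close>. With this shift and \<open>Z 0 = 0\<close>, comparing the coefficients of
    \<open>x ^ j\<close> in \<open>(xI - A) z = \<chi> v\<close> gives the same recursion for every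
    \<open>j\<close>, and the value at \<open>j = 0\<close> is the Cayley-Hamilton identity.\<close>
  define Z where "Z j = vec n (\<lambda>r. if j = 0 then 0 else coeff (z $ r) (j - 1))" for j
  have Zc: "Z j \<in> carrier_vec n" for j by (simp add: Z_def)
  have rec: "Z j = coeff ?\<chi> j \<cdot>\<^sub>v v + A *\<^sub>v Z (Suc j)" for j
  proof (rule eq_vecI)
    fix r assume "r < dim_vec (coeff ?\<chi> j \<cdot>\<^sub>v v + A *\<^sub>v Z (Suc j))"
    then have r: "r < n" using Zc by simp
    have "(?C *\<^sub>v z) $ r = [:0, 1:] * z $ r - (\<Sum>s<n. [:A $$ (r, s):] * z $ s)"
    proof -
      have "(?C *\<^sub>v z) $ r = (\<Sum>s<n. ?C $$ (r, s) * z $ s)"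
        using r z by (auto simp: Cd scalar_prod_def atLeast0LessThan intro!: sum.cong)
      also have "\<dots> = (\<Sum>s<n. (if s = r then [:0, 1:] * z $ r else 0) - [:A $$ (r, s):] * z $ s)"
        using r by (intro sum.cong) (auto simp: char_poly_matrix_def algebra_simps)
      also have "\<dots> = [:0, 1:] * z $ r - (\<Sum>s<n. [:A $$ (r, s):] * z $ s)"
        using r by (simp add: sum_subtractf)
      finally show ?thesis .
    qed
    then have "?\<chi> * [:v $ r:] = [:0, 1:] * z $ r - (\<Sum>s<n. [:A $$ (r, s):] * z $ s)"
      using r v by (simp add: Cz)
    then have "coeff (?\<chi> * [:v $ r:]) j
        = coeff ([:0, 1:] * z $ r - (\<Sum>s<n. [:A $$ (r, s):] * z $ s)) j"
      by simp
    then have "coeff ?\<chi> j * v $ r = Z j $ r - (\<Sum>s<n. A $$ (r, s) * coeff (z $ s) j)"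
      using r by (cases j) (simp_all add: Z_def coeff_sum mult.commute)
    moreover have "(A *\<^sub>v Z (Suc j)) $ r = (\<Sum>s<n. A $$ (r, s) * coeff (z $ s) j)"
      using r by (simp add: scalar_prod_def atLeast0LessThan Z_def)
    ultimately show "Z j $ r = (coeff ?\<chi> j \<cdot>\<^sub>v v + A *\<^sub>v Z (Suc j)) $ r"
      using r v by simp
  qed (simp add: Z_def)
  obtain N where N: "\<And>j. N \<le> j \<Longrightarrow> coeff ?\<chi> j = 0" "\<And>j. N < j \<Longrightarrow> Z j = 0\<^sub>v n"
  proof
    let ?N = "Suc (degree ?\<chi> + (\<Sum>r<n. degree (z $ r)))"
    show "coeff ?\<chi> j = 0" if "?N \<le> j" for j using that by (intro coeff_eq_0) simp
    show "Z j = 0\<^sub>v n" if "?N < j" for j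
    proof (rule eq_vecI)
      fix r assume "r < dim_vec (0\<^sub>v n)"
      then have r: "r < n" by simp
      have "degree (z $ r) \<le> (\<Sum>r<n. degree (z $ r))"
        using r by (intro member_le_sum) auto
      then have "degree (z $ r) < j - 1" using that by simp
      then show "Z j $ r = 0\<^sub>v n $ r" using r by (simp add: Z_def coeff_eq_0)
    qed (simp add: Z_def)
  qed
  have Zact: "Z j = act (poly_shift j ?\<chi>) v" for j
  proof (induction "Suc N - j" arbitrary: j)
    case 0
    then have "poly_shift j ?\<chi> = 0" by (simp add: poly_eq_iff coeff_poly_shift N)
    then show ?case using 0 v by (simp add: N act_0)
  next
    case (Suc x)
    then have IH: "Z (Suc j) = act (poly_shift (Suc j) ?\<chi>) v" by (intro Suc.hyps) simp
    have "poly_shift j ?\<chi> = pCons (coeff ?\<chi> j) (poly_shift (Suc j) ?\<chi>)"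
      by (auto simp: poly_eq_iff coeff_poly_shift coeff_pCons split: nat.splits)
    then show ?case using v by (simp add: act_pCons rec[of j] IH)
  qed
  show ?thesis
  proof (rule that[OF z Cz])
    show "r < n \<Longrightarrow> coeff (z $ r) j = act (poly_shift (Suc j) ?\<chi>) v $ r" for r j
      by (simp add: Z_def flip: Zact)
    show "act ?\<chi> v = 0\<^sub>v n"
      using Zact[of 0] by (auto simp: Z_def zero_vec_def)
  qed
qed

lemma act_char_poly: "v \<in> carrier_vec n \<Longrightarrow> act (char_poly A) v = 0\<^sub>v n"
  using adj_char_poly_matrix by metis

end

text \<open>The vector \<open>z\<close> stands for \<open>adj M a\<close>. The bordered matrix with
  blocks \<open>M\<close>, \<open>-a\<close>, \<open>b\<close>, 1 is cleared in two ways: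
  \<open>?Q\<close> removes the row \<open>b\<close> and leaves the rank-one update, while
  \<open>?R\<close> removes the column \<open>-a\<close> by \<open>M z = det M a\<close> and leaves
  \<open>det M + b \<bullet> z\<close> in the corner. The second way costs a factor
  \<open>det M\<close>, which is cancelled at the end.\<close>

lemma det_add_outer_product:
  fixes M :: "'a :: idom mat"
  assumes M: "M \<in> carrier_mat n n" and a: "a \<in> carrier_vec n" and b: "b \<in> carrier_vec n"
    and z: "z \<in> carrier_vec n" and Mz: "M *\<^sub>v z = det M \<cdot>\<^sub>v a" and "det M \<noteq> 0"
  shows "det (mat n n (\<lambda>(i, j). M $$ (i, j) + a $ i * b $ j)) = det M + b \<bullet> z"
proof -
  let ?a = "mat n 1 (\<lambda>(i, _). - a $ i)" and ?b = "mat 1 n (\<lambda>(_, j). b $ j)"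
  let ?z = "mat n 1 (\<lambda>(i, _). z $ i)" and ?d = "mat 1 1 (\<lambda>_. det M)"
  let ?B = "mat n n (\<lambda>(i, j). M $$ (i, j) + a $ i * b $ j)"
  let ?s = "mat 1 1 (\<lambda>_. det M + b \<bullet> z)"
  let ?P = "four_block_mat M ?a ?b (1\<^sub>m 1)"
  let ?Q = "four_block_mat (1\<^sub>m n) (0\<^sub>m n 1) (- ?b) (1\<^sub>m 1)"
  let ?R = "four_block_mat (1\<^sub>m n) ?z (0\<^sub>m 1 n) ?d"
  have det1: "det (mat 1 1 (\<lambda>_. x)) = x" "det (mat (Suc 0) (Suc 0) (\<lambda>_. x)) = x" for x :: 'a
    by (simp_all add: det_single)
  have "?P * ?Q = four_block_mat (M * 1\<^sub>m n + ?a * - ?b) (M * 0\<^sub>m n 1 + ?a * 1\<^sub>m 1)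
    (?b * 1\<^sub>m n + 1\<^sub>m 1 * - ?b) (?b * 0\<^sub>m n 1 + 1\<^sub>m 1 * 1\<^sub>m 1)"
    using M by (intro mult_four_block_mat) auto
  also have "M * 1\<^sub>m n + ?a * - ?b = ?B"
    using M by (intro eq_matI) (auto simp: scalar_prod_def)
  also have "?b * 1\<^sub>m n + 1\<^sub>m 1 * - ?b = 0\<^sub>m 1 n"
    by (intro eq_matI) (auto simp: scalar_prod_def)
  also have "?b * 0\<^sub>m n 1 + 1\<^sub>m 1 * 1\<^sub>m 1 = 1\<^sub>m 1"
    by (intro eq_matI) (auto simp: scalar_prod_def)
  also have "det (four_block_mat ?B (M * 0\<^sub>m n 1 + ?a * 1\<^sub>m 1) (0\<^sub>m 1 n) (1\<^sub>m 1)) = det ?B * det (1\<^sub>m 1)"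
    using M by (intro det_four_block_mat_lower_left_zero) auto
  finally have "det (?P * ?Q) = det ?B" by simp
  moreover have "det (?P * ?Q) = det ?P * det ?Q"
    using M by (intro det_mult[of _ "n + 1"]) auto
  moreover have "det ?Q = 1"
    by (subst det_four_block_mat_upper_right_zero) auto
  ultimately have PB: "det ?P = det ?B" by simp
  have "?P * ?R = four_block_mat (M * 1\<^sub>m n + ?a * 0\<^sub>m 1 n) (M * ?z + ?a * ?d)
    (?b * 1\<^sub>m n + 1\<^sub>m 1 * 0\<^sub>m 1 n) (?b * ?z + 1\<^sub>m 1 * ?d)"
    using M by (intro mult_four_block_mat) auto
  also have "M * 1\<^sub>m n + ?a * 0\<^sub>m 1 n = M" using M by (intro eq_matI) auto
  also have "M * ?z + ?a * ?d = 0\<^sub>m n 1"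
  proof (rule eq_matI)
    fix i j assume "i < dim_row (0\<^sub>m n 1 :: 'a mat)" "j < dim_col (0\<^sub>m n 1 :: 'a mat)"
    then have ij: "i < n" "j = 0" by auto
    have "(M * ?z) $$ (i, j) = (M *\<^sub>v z) $ i"
      using M z ij by (auto simp: scalar_prod_def intro!: sum.cong)
    then show "(M * ?z + ?a * ?d) $$ (i, j) = 0\<^sub>m n 1 $$ (i, j)"
      using M a ij by (simp add: Mz scalar_prod_def mult.commute)
  qed (use M in auto)
  also have "?b * ?z + 1\<^sub>m 1 * ?d = ?s"
    using z b by (intro eq_matI) (auto simp: scalar_prod_def)
  also have "det (four_block_mat M (0\<^sub>m n 1) (?b * 1\<^sub>m n + 1\<^sub>m 1 * 0\<^sub>m 1 n) ?s) = det M * det ?s"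
    using M by (intro det_four_block_mat_upper_right_zero) auto
  finally have "det (?P * ?R) = det M * (det M + b \<bullet> z)" by (simp only: det1)
  moreover have "det (?P * ?R) = det ?P * det ?R"
    using M by (intro det_mult[of _ "n + 1"]) auto
  moreover have "det ?R = det M"
    by (subst det_four_block_mat_lower_left_zero[of _ n _ 1]) (auto simp: det1)
  ultimately show ?thesis using PB \<open>det M \<noteq> 0\<close> by simp
qed

section \<open>The cyclic module generated by a dual walk vector\<close>

lemma (in square_mat) act_sum:
  assumes "v \<in> carrier_vec n" "u \<in> carrier_vec n"
  shows "act (\<Sum>i\<in>I. f i) v \<bullet> u = (\<Sum>i\<in>I. act (f i) v \<bullet> u)"
proof (induction I rule: infinite_finite_induct)
  case (insert i I)
  then show ?case using assms by (simp add: act_add add_scalar_prod_distrib[of _ n])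
qed (use assms in \<open>simp_all add: act_0\<close>)

lemma (in square_mat) act_adjoint_sym:
  assumes sym: "transpose_mat A = A" and "u \<in> carrier_vec n" "v \<in> carrier_vec n"
  shows "act f u \<bullet> v = u \<bullet> act f v"
  using assms(3)
proof (induction f arbitrary: v)
  case 0
  then show ?case using assms(2) by (simp add: act_0)
next
  case (pCons a f)
  note [simp] = assms(2) pCons.prems
  have "act (pCons 0 1) v = A *\<^sub>v v" "act (pCons 0 1) (act f v) = A *\<^sub>v act f v"
    by (simp_all add: act_pCons_0 act_1)
  then have comm: "act f (A *\<^sub>v v) = A *\<^sub>v act f v"
    using act_commute[of v f "pCons 0 1"] by simp
  have "(A *\<^sub>v act f u) \<bullet> v = act f u \<bullet> (A *\<^sub>v v)"
    using transpose_vec_mult_scalar[OF A, of v "act f u"] by (simp add: sym)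
  also have "\<dots> = u \<bullet> (A *\<^sub>v act f v)" by (simp add: pCons.IH comm)
  finally show ?case
    by (simp add: act_pCons add_scalar_prod_distrib[of _ n] scalar_prod_add_distrib[of _ n]
      smult_scalar_prod_distrib[of _ n] scalar_prod_smult_distrib[of _ n])
qed

text \<open>By \<open>nondegenerate\<close> the walk vectors of \<open>e\<close> span the rational
  space, and by \<open>e_w\<close> the vector \<open>w\<close> is \<open>d\<close> times the last
  member of their dual basis. The other dual vectors come from applying polynomials in
  \<open>A\<close> to \<open>w\<close>.\<close>

locale cyclic_pair = square_mat A n for A :: "int mat" and n +
  fixes e w :: "int vec" and d :: int
  assumes sym: "transpose_mat A = A"
    and e [simp]: "e \<in> carrier_vec n" and w [simp]: "w \<in> carrier_vec n"
    and n_pos: "0 < n" and d_nonzero: "d \<noteq> 0"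
    and e_w: "\<And>k. k < n \<Longrightarrow> act (monom 1 k) e \<bullet> w = (if k = n - 1 then d else 0)"
    and nondegenerate: "\<And>u. u \<in> carrier_vec n \<Longrightarrow>
      (\<And>k. k < n \<Longrightarrow> act (monom 1 k) e \<bullet> u = 0) \<Longrightarrow> u = 0\<^sub>v n"
begin

lemmas act_adjoint = act_adjoint_sym[OF sym]

abbreviation \<chi> :: "int poly" where "\<chi> \<equiv> char_poly A"

abbreviation moment :: "int vec \<Rightarrow> nat \<Rightarrow> int" where
  "moment v k \<equiv> act (monom 1 k) e \<bullet> v"

text \<open>On remainders modulo \<open>\<chi>\<close> this functional is \<open>d\<close> times the
  coefficient of \<open>x ^ (n - 1)\<close>. Through \<open>act_w\<close> it describes the whole
  pairing between the lattices generated by \<open>e\<close> and by \<open>w\<close>.\<close>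

definition phi :: "int poly \<Rightarrow> int" where "phi f = act f e \<bullet> w"

text \<open>The Horner quotients of \<open>\<chi>\<close>. Up to the factor \<open>d\<close> they
  are the basis dual to the powers of \<open>x\<close> with respect to \<open>phi\<close>.\<close>

definition horner :: "nat \<Rightarrow> int poly" where "horner m = poly_shift (Suc m) \<chi>"

definition dual_poly :: "(nat \<Rightarrow> int) \<Rightarrow> int poly" where
  "dual_poly c = (\<Sum>m<n. smult (c m) (horner m))"

lemma char_poly_degree: "degree \<chi> = n" "coeff \<chi> n = 1"
  using degree_monic_char_poly[OF A] by auto

lemma act_w: "act f e \<bullet> act g w = phi (f * g)"
proof -
  have "act f e \<bullet> act g w = act g (act f e) \<bullet> w" by (simp add: act_adjoint)
  then show ?thesis by (simp add: phi_def act_mult act_commute[of e f g])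
qed

lemma phi_diff: "phi (f - g) = phi f - phi g"
  by (simp add: phi_def act_diff minus_scalar_prod_distrib[of _ n])

lemma phi_smult: "phi (smult c f) = c * phi f"
  by (simp add: phi_def act_smult smult_scalar_prod_distrib[of _ n])

lemma phi_sum: "phi (\<Sum>i\<in>I. f i) = (\<Sum>i\<in>I. phi (f i))"
  by (simp add: phi_def act_sum)

lemma phi_low:
  assumes "\<And>i. n \<le> i \<Longrightarrow> coeff f i = 0"
  shows "phi f = d * coeff f (n - 1)"
proof -
  have "phi f = (\<Sum>i<n. coeff f i * (if i = n - 1 then d else 0))"
    unfolding phi_def using act_scalar_prod_sum[OF e w assms] by (simp add: e_w)
  also have "\<dots> = (\<Sum>i<n. if i = n - 1 then d * coeff f i else 0)"
    by (intro sum.cong) auto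
  finally show ?thesis using n_pos by simp
qed

lemma phi_char_poly: "phi (\<chi> * f) = 0"
  by (simp add: phi_def act_mult act_char_poly)

lemma coeff_char_poly_eq_0: "n < i \<Longrightarrow> coeff \<chi> i = 0"
  by (simp add: coeff_eq_0 char_poly_degree)

lemma coeff_horner: "coeff (horner m) i = coeff \<chi> (Suc (i + m))"
  by (simp add: horner_def coeff_poly_shift)

text \<open>\<open>horner m\<close> is monic of degree \<open>n - 1 - m\<close>. For
  \<open>k \<le> m\<close> the product has degree at most \<open>n - 1\<close>, reached only when
  \<open>k = m\<close>. For \<open>k > m\<close> it differs from a multiple of \<open>\<chi>\<close>
  by a polynomial of degree below \<open>k\<close>, whose coefficient at \<open>n - 1\<close>
  vanishes.\<close>

lemma phi_horner:
  assumes "k < n" "m < n"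
  shows "phi (monom 1 k * horner m) = (if k = m then d else 0)"
proof (cases "k \<le> m")
  case True
  have "phi (monom 1 k * horner m) = d * coeff (monom 1 k * horner m) (n - 1)"
    using True assms by (intro phi_low) (auto simp: coeff_monom_mult coeff_horner coeff_char_poly_eq_0)
  moreover have "coeff (monom 1 k * horner m) (n - 1) = (if k = m then 1 else 0)"
  proof (cases "k = m")
    case eq: True
    have "Suc (n - 1 - k + m) = n" using eq assms by simp
    then show ?thesis using eq assms by (simp add: coeff_monom_mult coeff_horner char_poly_degree)
  next
    case False
    then show ?thesis using True assms
      by (simp add: coeff_monom_mult coeff_horner coeff_char_poly_eq_0)
  qed
  ultimately show ?thesis by simp
next
  case False
  let ?r = "\<chi> * monom 1 (k - Suc m) - monom 1 k * horner m"
  have r: "coeff ?r i = 0" if "k \<le> i" for i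
  proof -
    have "coeff (\<chi> * monom 1 (k - Suc m)) i = coeff \<chi> (i - (k - Suc m))"
      using that False by (simp add: coeff_monom_mult mult.commute[of \<chi>])
    moreover have "i - (k - Suc m) = Suc (i - k + m)" using that False by simp
    ultimately show ?thesis using that by (simp add: coeff_monom_mult coeff_horner)
  qed
  have "phi ?r = d * coeff ?r (n - 1)" using assms by (intro phi_low r) simp
  also have "coeff ?r (n - 1) = 0" using assms by (intro r) simp
  finally show ?thesis using False by (simp add: phi_diff phi_char_poly)
qed

lemma phi_dual_poly: "k < n \<Longrightarrow> phi (monom 1 k * dual_poly c) = d * c k"
proof -
  assume k: "k < n"
  have "phi (monom 1 k * dual_poly c) = (\<Sum>m<n. c m * phi (monom 1 k * horner m))"
    by (simp add: dual_poly_def sum_distrib_left phi_sum phi_smult)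
  also have "\<dots> = (\<Sum>m<n. if m = k then d * c m else 0)"
    using k by (intro sum.cong) (auto simp: phi_horner)
  finally show ?thesis using k by simp
qed

lemma eq_if_moments_eq:
  assumes "u \<in> carrier_vec n" "v \<in> carrier_vec n" "\<And>k. k < n \<Longrightarrow> moment u k = moment v k"
  shows "u = v"
proof -
  have "u - v = 0\<^sub>v n" using assms
    by (intro nondegenerate) (auto simp: scalar_prod_minus_distrib[of _ n])
  then have "(u - v) $ i = 0" if "i < n" for i using that by simp
  then show ?thesis using assms by (intro eq_vecI) auto
qed

text \<open>This places \<open>d \<int>\<^sup>n\<close> inside the lattice generated by
  \<open>w\<close>: a vector is determined by its pairings with the walk vectors, and
  \<open>dual_poly\<close> is built to have prescribed pairings.\<close>

lemma act_dual_poly: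
  assumes "b \<in> carrier_vec n"
  shows "act (dual_poly (moment b)) w = d \<cdot>\<^sub>v b"
  using assms by (intro eq_if_moments_eq) (auto simp: act_w phi_dual_poly)

text \<open>Multiplying a nonzero remainder \<open>r\<close> by the power of \<open>x\<close> that
  lifts its degree to \<open>n - 1\<close> makes \<open>phi\<close> return
  \<open>d * lead_coeff r\<close>, which is not 0.\<close>

lemma act_eq_0_imp_char_poly_dvd:
  assumes "act g w = 0\<^sub>v n"
  shows "\<chi> dvd g"
proof -
  have "monic \<chi>" by (simp add: char_poly_degree)
  then obtain q r where g: "g = \<chi> * q + r" "r = 0 \<or> degree r < n"
    using monic_divmod[of \<chi> g] by (auto simp: char_poly_degree)
  have "r = 0"
  proof (rule ccontr)
    assume r0: "r \<noteq> 0"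
    let ?k = "n - 1 - degree r"
    have r: "degree r < n" using g r0 by simp
    have "monom 1 ?k * r = monom 1 ?k * g - \<chi> * (monom 1 ?k * q)"
      by (simp add: g(1) algebra_simps)
    then have "phi (monom 1 ?k * r) = phi (monom 1 ?k * g)"
      by (simp only: phi_diff phi_char_poly)
    also have "\<dots> = 0" using assms by (simp flip: act_w)
    finally have "phi (monom 1 ?k * r) = 0" .
    moreover have "phi (monom 1 ?k * r) = d * coeff (monom 1 ?k * r) (n - 1)"
      using r by (intro phi_low) (auto simp: coeff_monom_mult intro!: coeff_eq_0)
    moreover have "coeff (monom 1 ?k * r) (n - 1) = lead_coeff r"
    proof -
      have "n - 1 - ?k = degree r" using r by simp
      then show ?thesis by (simp add: coeff_monom_mult)
    qed
    ultimately show False using r0 d_nonzero by simp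
  qed
  then show ?thesis using g by simp
qed

text \<open>The vectors \<open>act (horner m) w\<close> are \<open>d\<close> times the dual basis of
  the walk vectors, so this is the expansion of \<open>v\<close> in the walk basis with denominators
  cleared.\<close>

lemma smult_eq_act_e:
  assumes v: "v \<in> carrier_vec n"
  shows "d \<cdot>\<^sub>v v = act (\<Sum>m<n. monom (act (horner m) w \<bullet> v) m) e"
proof (rule vec_eq_if_scalar_prod_eq[of _ n])
  fix b :: "int vec" assume b: "b \<in> carrier_vec n"
  have "b \<bullet> (d \<cdot>\<^sub>v v) = (d \<cdot>\<^sub>v b) \<bullet> v" using b v by simp
  also have "\<dots> = act (dual_poly (moment b)) w \<bullet> v" using b by (simp add: act_dual_poly)
  also have "\<dots> = (\<Sum>m<n. moment b m * (act (horner m) w \<bullet> v))"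
    using v by (simp add: dual_poly_def act_sum act_smult)
  also have "\<dots> = (\<Sum>m<n. act (monom (act (horner m) w \<bullet> v) m) e \<bullet> b)"
  proof (rule sum.cong[OF refl])
    fix m
    have eq: "act (monom c m) e = c \<cdot>\<^sub>v act (monom 1 m) e" for c
      using act_smult[OF e, of c "monom 1 m"] by (simp add: smult_monom)
    show "moment b m * (act (horner m) w \<bullet> v) = act (monom (act (horner m) w \<bullet> v) m) e \<bullet> b"
      unfolding eq[of "act (horner m) w \<bullet> v"] smult_scalar_prod_distrib[OF act_closed[OF e] b] by (rule mult.commute)
  qed
  also have "\<dots> = act (\<Sum>m<n. monom (act (horner m) w \<bullet> v) m) e \<bullet> b"
    using b by (simp add: act_sum)
  also have "\<dots> = b \<bullet> act (\<Sum>m<n. monom (act (horner m) w \<bullet> v) m) e"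
    using b by (intro comm_scalar_prod[of _ n]) auto
  finally show "b \<bullet> (d \<cdot>\<^sub>v v) = b \<bullet> act (\<Sum>m<n. monom (act (horner m) w \<bullet> v) m) e" .
qed (use v in auto)

text \<open>The \<open>E\<close> of the overview, obtained here as the polynomial that represents
  \<open>d e\<close>. \<open>numerator_poly_eq\<close> and \<open>char_poly_add_all_ones\<close>
  identify it with the difference of the characteristic polynomials.\<close>

definition numerator_poly :: "int poly" where "numerator_poly = dual_poly (moment e)"

lemma act_numerator_poly: "act numerator_poly w = d \<cdot>\<^sub>v e"
  by (simp add: numerator_poly_def act_dual_poly)

lemma act_poly_scalar_prod_dvd:
  assumes "\<And>k. m dvd act (monom 1 k) u \<bullet> v" "u \<in> carrier_vec n" "v \<in> carrier_vec n"
  shows "m dvd act f u \<bullet> v"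
proof -
  have "act f u \<bullet> v = (\<Sum>i<Suc (degree f). coeff f i * (act (monom 1 i) u \<bullet> v))"
    using assms by (intro act_scalar_prod_sum) (auto intro: coeff_eq_0)
  then show ?thesis using assms(1) by (simp only: dvd_sum dvd_mult)
qed

end

section \<open>Localization at a prime that divides \<open>d\<close> exactly once\<close>

locale cyclic_pair_mod = cyclic_pair A n e w d + prime_poly_mod p
  for A :: "int mat" and n e w d and p :: int +
  fixes d' :: int
  assumes d: "d = p * d'" and d': "\<not> p dvd d'"
begin

lemma p_neq_0: "p \<noteq> 0" using m_gt_1 by simp

text \<open>Locally at \<open>p\<close> this is the ideal of \<open>\<int>\<^sup>n\<close>: as
  \<open>d'\<close> is prime to \<open>p\<close>, the vector \<open>f(A) w / d\<close> is integral
  at \<open>p\<close> exactly when \<open>f(A) w\<close> is a multiple of \<open>p\<close>.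
  Equivalently, \<open>f\<close> annihilates \<open>w\<close> modulo \<open>p\<close>, which
  explains the name.\<close>

definition annihilates :: "int poly \<Rightarrow> bool" where
  "annihilates f \<longleftrightarrow> (\<exists>v\<in>carrier_vec n. act f w = p \<cdot>\<^sub>v v)"

lemma annihilates_mult: "annihilates f \<Longrightarrow> annihilates (g * f)"
  unfolding annihilates_def by (metis act_mult[OF w] act_vec_smult act_closed)

lemma annihilates_add: "annihilates f \<Longrightarrow> annihilates g \<Longrightarrow> annihilates (f + g)"
  unfolding annihilates_def by (metis act_add[OF w] smult_add_distrib_vec add_carrier_vec)

lemma annihilates_smult: "annihilates f \<Longrightarrow> annihilates (smult c f)"
  using annihilates_mult[of f "[:c:]"] by simp

lemma annihilates_smult_p: "annihilates (smult p f)"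
  unfolding annihilates_def using act_smult[OF w] by auto

lemma annihilates_cong: "f =m g \<Longrightarrow> annihilates g \<Longrightarrow> annihilates f"
  using eq_m_imp_add_smult[of f g] annihilates_add annihilates_smult_p by auto

lemma annihilates_dvdm: "f dvdm g \<Longrightarrow> annihilates f \<Longrightarrow> annihilates g"
  unfolding dvdm_def using annihilates_cong annihilates_mult by (metis mult.commute)

lemma annihilates_diff: "annihilates f \<Longrightarrow> annihilates g \<Longrightarrow> annihilates (f - g)"
  using annihilates_add[of f "smult (-1) g"] annihilates_smult[of g "-1"] by simp

lemma annihilatesI:
  assumes "\<And>b. b \<in> carrier_vec n \<Longrightarrow> p dvd b \<bullet> act f w"
  shows "annihilates f"
  unfolding annihilates_def
proof
  have "p dvd act f w $ i" if "i < n" for i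
    using assms[of "unit_vec n i"] scalar_prod_left_unit[OF act_closed[OF w] that] by simp
  then show "act f w = p \<cdot>\<^sub>v vec n (\<lambda>i. act f w $ i div p)" by (intro eq_vecI) auto
qed simp

lemma smult_cancel:
  assumes "c \<cdot>\<^sub>v u = c \<cdot>\<^sub>v v" "c \<noteq> (0 :: int)" "u \<in> carrier_vec n" "v \<in> carrier_vec n"
  shows "u = v"
proof (rule eq_vecI)
  fix i assume "i < dim_vec v"
  then have "(c \<cdot>\<^sub>v u) $ i = (c \<cdot>\<^sub>v v) $ i" "i < n" using assms by auto
  then show "u $ i = v $ i" using assms(2-4) by simp
qed (use assms in auto)

text \<open>The divisibility puts \<open>u / p\<close> into \<open>M\<^sup>*\<close>, and
  \<open>d' u\<close> is \<open>d\<close> times that vector. Concretely,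
  \<open>dual_poly (moment u)\<close> represents \<open>d u\<close> and is divisible by
  \<open>p\<close>.\<close>

lemma obtain_representation:
  assumes u: "u \<in> carrier_vec n" and "\<And>k. k < n \<Longrightarrow> p dvd moment u k"
  obtains f where "act f w = d' \<cdot>\<^sub>v u"
proof
  let ?f = "dual_poly (\<lambda>k. moment u k div p)"
  have "dual_poly (moment u) = smult p ?f"
    using assms(2) by (simp add: dual_poly_def smult_sum2)
  then have "p \<cdot>\<^sub>v act ?f w = p \<cdot>\<^sub>v (d' \<cdot>\<^sub>v u)"
    using act_dual_poly[OF u] act_smult[OF w] by (simp add: d smult_smult_assoc)
  then show "act ?f w = d' \<cdot>\<^sub>v u" by (rule smult_cancel[OF _ p_neq_0]) (use u in auto)
qed

text \<open>\<open>g(A) w\<close> lies in \<open>p\<close> times the lattice spanned by the walk vectors \<open>A\<^sup>k e\<close>; since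
  \<open>d e = E(A) w\<close> and \<open>w\<close> is cyclic, \<open>g\<close> is modulo \<open>p\<close> in the ideal generated by \<open>E\<close> and \<open>\<chi>\<close>.\<close>

lemma dvdm_if_moments_dvd:
  assumes "f dvdm \<chi>" "f dvdm numerator_poly"
    and g: "\<And>k. p ^ 2 dvd act (monom 1 k) w \<bullet> act g w"
  shows "f dvdm g"
proof -
  let ?v = "act g w"
  have c: "p ^ 2 dvd act (horner k) w \<bullet> ?v" for k
    using g by (rule act_poly_scalar_prod_dvd) auto
  define C where "C = (\<Sum>k<n. monom ((act (horner k) w \<bullet> ?v) div p ^ 2) k)"
  have "(\<Sum>k<n. monom (act (horner k) w \<bullet> ?v) k) = smult (p ^ 2) C"
    unfolding C_def smult_sum2 using c by (simp add: smult_monom)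
  then have "d \<cdot>\<^sub>v ?v = (p ^ 2) \<cdot>\<^sub>v act C e"
    using smult_eq_act_e[of ?v] by (simp add: act_smult)
  then have "p \<cdot>\<^sub>v (d' \<cdot>\<^sub>v ?v) = p \<cdot>\<^sub>v (p \<cdot>\<^sub>v act C e)"
    by (simp add: d smult_smult_assoc power2_eq_square)
  then have 1: "d' \<cdot>\<^sub>v ?v = p \<cdot>\<^sub>v act C e"
    by (rule smult_cancel[OF _ p_neq_0]) auto
  \<comment> \<open>Since \<open>E(A) w = d e\<close>, a factor \<open>E\<close> turns an expression
    in \<open>e\<close> back into one in \<open>w\<close>, where relations between polynomials can
    be read off modulo \<open>\<chi>\<close>.\<close>
  have "act (C * numerator_poly) w = act C (d \<cdot>\<^sub>v e)" by (simp add: act_mult act_numerator_poly)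
  also have "\<dots> = d' \<cdot>\<^sub>v (p \<cdot>\<^sub>v act C e)"
    by (simp add: act_vec_smult d smult_smult_assoc mult.commute)
  also have "\<dots> = act (smult (d' ^ 2) g) w"
    by (simp add: act_smult smult_smult_assoc power2_eq_square flip: 1)
  finally have "act (smult (d' ^ 2) g - C * numerator_poly) w = 0\<^sub>v n"
    by (simp add: act_diff)
  then have "\<chi> dvd smult (d' ^ 2) g - C * numerator_poly" by (rule act_eq_0_imp_char_poly_dvd)
  then have "f dvdm smult (d' ^ 2) g - C * numerator_poly"
    using assms(1) dvd_imp_dvdm dvdm_trans by blast
  then have "f dvdm (smult (d' ^ 2) g - C * numerator_poly) + C * numerator_poly"
    using assms(2) by (intro dvdm_add dvdm_mult)
  then have *: "f dvdm smult (d' ^ 2) g" by simp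
  have "coprime (d' ^ 2) p" using prime_imp_coprime[OF prime d']
    by (simp add: algebraic_semidom_class.coprime_commute[of d'])
  then obtain x where "[d' ^ 2 * x = 1] (mod p)" using cong_solve_coprime_int[of "d' ^ 2" p] by auto
  then have x: "M (x * d' ^ 2) = 1" using m_gt_1 by (simp add: cong_def M_def mult.commute)
  have "smult x (smult (d' ^ 2) g) =m g"
    using Mp_smult(1)[of "x * d' ^ 2" g] by (simp add: x)
  then show ?thesis using dvdm_smult[OF *, of x] dvdm_cong by blast
qed

text \<open>As \<open>A\<close> is symmetric, one factor \<open>f\<close> moves across the scalar
  product. The condition on the form at \<open>u\<close> thus becomes a condition on
  \<open>f ^ 2\<close>, which is how isotropic lattices turn into square-zero ideals.\<close>

lemma moments_square_dvd:
  assumes f: "act f w = c \<cdot>\<^sub>v u" and u: "u \<in> carrier_vec n"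
    and "\<And>k. p ^ 2 dvd c ^ 2 * (act (monom 1 k) u \<bullet> u)"
  shows "p ^ 2 dvd act (monom 1 k) w \<bullet> act (f ^ 2) w"
proof -
  have "act (monom 1 k) w \<bullet> act (f ^ 2) w = act (monom 1 k) (act f w) \<bullet> act f w"
    using act_adjoint[of "act (monom 1 k) w" "act f w" f] act_commute[OF w, of f "monom 1 k"]
    by (simp add: power2_eq_square act_mult)
  also have "\<dots> = c ^ 2 * (act (monom 1 k) u \<bullet> u)"
    using u by (simp add: f act_vec_smult power2_eq_square smult_scalar_prod_distrib[of _ n]
        scalar_prod_smult_distrib[of _ n])
  finally show ?thesis using assms(3) by simp
qed

lemma annihilates_square_dvdm:
  assumes "annihilates f" "h dvdm \<chi>" "h dvdm numerator_poly"
  shows "h dvdm f ^ 2"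
proof -
  obtain u where "u \<in> carrier_vec n" "act f w = p \<cdot>\<^sub>v u"
    using assms(1) by (auto simp: annihilates_def)
  then have "p ^ 2 dvd act (monom 1 k) w \<bullet> act (f ^ 2) w" for k
    by (intro moments_square_dvd) auto
  then show ?thesis by (rule dvdm_if_moments_dvd[OF assms(2,3)])
qed

lemma dvd_of_annihilates:
  assumes "annihilates f" "act f w = d' \<cdot>\<^sub>v u" "u \<in> carrier_vec n" "i < n"
  shows "p dvd u $ i"
proof -
  obtain v where v: "v \<in> carrier_vec n" "d' \<cdot>\<^sub>v u = p \<cdot>\<^sub>v v"
    using assms(1,2) by (auto simp: annihilates_def)
  then have "(d' \<cdot>\<^sub>v u) $ i = (p \<cdot>\<^sub>v v) $ i" by simp
  then have "d' * u $ i = p * v $ i" using v(1) assms(3,4) by simp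
  then have "p dvd d' * u $ i" by simp
  then show ?thesis using prime d' by (simp add: prime_dvd_mult_iff)
qed

text \<open>In the application \<open>h\<close> is \<open>\<Phi>\<^sub>p\<close> and
  \<open>S\<close> its \<open>sqrt\<close>. The polynomial \<open>S\<close> divides both
  \<open>P\<close> and the polynomial \<open>f\<close> of \<open>u\<close>; by the degree bound
  \<open>P\<close> is a constant multiple of \<open>S\<close> modulo \<open>p\<close>. Hence
  \<open>S\<close> annihilates, and so does its multiple \<open>f\<close>.\<close>

lemma dvd_of_isotropic_sqrt:
  assumes S: "monic S" "\<And>g. h dvdm g ^ 2 \<Longrightarrow> S dvdm g"
    and h: "h dvdm \<chi>" "h dvdm numerator_poly"
    and P: "annihilates P" "Mp P \<noteq> 0" "degree_m P \<le> degree S"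
    and u: "u \<in> carrier_vec n" "\<And>k. k < n \<Longrightarrow> p dvd moment u k"
      "\<And>k. p ^ 2 dvd act (monom 1 k) u \<bullet> u"
    and i: "i < n"
  shows "p dvd u $ i"
proof -
  obtain f where f: "act f w = d' \<cdot>\<^sub>v u" using obtain_representation[OF u(1,2)] by blast
  have "p ^ 2 dvd act (monom 1 k) w \<bullet> act (f ^ 2) w" for k
    using u by (intro moments_square_dvd[OF f]) auto
  then have Sf: "S dvdm f" by (intro S(2) dvdm_if_moments_dvd[OF h])
  have "S dvdm P" by (intro S(2) annihilates_square_dvdm P(1) h)
  then obtain q where q: "P =m S * q" "Mp q = q" by (elim dvdmE)
  then have "q \<noteq> 0" using P(2) by auto
  then have "degree q = 0" using monic_mult_Mp(1)[OF S(1) q(2)] P(3) q(1) by simp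
  have "Mp q \<noteq> 0" using q \<open>q \<noteq> 0\<close> by simp
  from normalize_m[OF this] obtain c where c: "monic (Mp (smult c q))"
    "degree_m (smult c q) = degree q" using q by auto
  then obtain a where "Mp (smult c q) = [:a:]"
    using \<open>degree q = 0\<close> degree_eq_zeroE[of "Mp (smult c q)"] by auto
  then have "smult c q =m 1" using c m_gt_1 by (simp add: Mp_def M_def)
  then have "S * smult c q =m S" using eq_m_mult[of S S "smult c q" 1] by simp
  moreover have "S * smult c q =m smult c P"
    using eq_m_mult[of "[:c:]" "[:c:]", OF refl q(1)] by simp
  ultimately have "annihilates S"
    using annihilates_cong[of S "smult c P"] annihilates_smult[OF P(1)] by simp
  then have "annihilates f" using Sf annihilates_dvdm by blast
  then show ?thesis using f u(1) i by (rule dvd_of_annihilates)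
qed

end

section \<open>Squares modulo a prime, with the prime 2 singled out\<close>

context prime_poly_mod
begin

lemma square_eq_m_0:
  assumes "Mp (f ^ 2) = 0"
  shows "Mp f = 0"
proof (rule ccontr)
  assume "Mp f \<noteq> 0"
  then obtain c where c: "monic (Mp (smult c f))" using normalize_m by blast
  have "Mp (smult c f) * Mp (smult c f) =m smult (c * c) (f ^ 2)"
    using eq_m_mult[of "Mp (smult c f)" "smult c f" "Mp (smult c f)" "smult c f"]
    by (simp add: power2_eq_square)
  also have "Mp (smult (c * c) (f ^ 2)) = 0"
    using Mp_smult(2)[of "c * c" "f ^ 2"] assms by simp
  finally have "Mp (Mp (smult c f)) = 0" by (rule monic_mult_eq_m_0[OF c])
  then show False using c by simp
qed

text \<open>Squaring is additive modulo 2, so with \<open>f = g q + r\<close> the square of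
  \<open>g\<close> divides \<open>r ^ 2\<close>. The degree of \<open>r\<close> is too small for
  this unless \<open>r\<close> vanishes. No factorization into irreducibles enters.\<close>

lemma square_dvdm_square_char_2:
  assumes "m = 2" and g: "monic g" and "g ^ 2 dvdm f ^ 2"
  shows "g dvdm f"
proof -
  obtain q r where qr: "f = g * q + r" "r = 0 \<or> degree r < degree g"
    using monic_divmod[OF g, of f] by blast
  have "r ^ 2 + smult m (g * q * r) = f ^ 2 - g ^ 2 * q ^ 2"
    by (simp add: qr(1) assms(1) power2_eq_square algebra_simps numeral_poly
        smult_add_left[of 1 1, simplified])
  moreover have "r ^ 2 =m r ^ 2 + smult m (g * q * r)" by (simp add: eq_m_iff_dvd)
  ultimately have r2: "r ^ 2 =m f ^ 2 - g ^ 2 * q ^ 2" by simp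
  have "g ^ 2 dvdm f ^ 2 - g ^ 2 * q ^ 2"
    using assms(3) by (intro dvdm_diff dvdm_mult2 dvdm_refl)
  then have "g ^ 2 dvdm r ^ 2" using dvdm_cong[OF r2] by simp
  have "Mp r = 0"
  proof (rule ccontr)
    assume r0: "Mp r \<noteq> 0"
    then have "Mp (r ^ 2) \<noteq> 0" using square_eq_m_0 by blast
    then have "degree (g ^ 2) \<le> degree_m (r ^ 2)"
      using \<open>g ^ 2 dvdm r ^ 2\<close> monic_power[OF g] by (intro degree_monic_dvdm)
    also have "\<dots> \<le> degree (r ^ 2)" by (rule degree_m_le)
    finally have "degree g \<le> degree r"
      using degree_power_eq[of g 2] degree_power_eq[of r 2] g r0 by (cases "g = 0"; cases "r = 0") simp_all
    then show False using qr(2) r0 by auto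
  qed
  then have "f =m g * q" using qr(1) eq_m_add[of "g * q" "g * q" r 0] by simp
  then show ?thesis by (rule dvdmI)
qed

end

context cyclic_pair_mod
begin

text \<open>The annihilating polynomials form an ideal that contains \<open>p\<close> and, by
  Cayley-Hamilton, the monic \<open>\<chi>\<close>. A monic member of least degree generates it
  modulo \<open>p\<close>.\<close>

lemma monic_annihilator:
  obtains P where "monic P" "annihilates P" "\<And>f. annihilates f \<Longrightarrow> P dvdm f"
proof -
  let ?P = "\<lambda>f. monic f \<and> annihilates f"
  have "annihilates \<chi>"
    unfolding annihilates_def using w by (auto simp: act_char_poly intro!: bexI[of _ "0\<^sub>v n"])
  then have "?P \<chi>" by (simp add: char_poly_degree)
  then obtain P where P: "?P P" and min: "\<And>f. ?P f \<Longrightarrow> degree P \<le> degree f"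
    using ex_has_least_nat[of ?P \<chi> degree] by blast
  have "P dvdm f" if f: "annihilates f" for f
  proof -
    obtain q r where qr: "f = P * q + r" "r = 0 \<or> degree r < degree P"
      using monic_divmod[of P f] P by blast
    have "annihilates (f - q * P)" using f P annihilates_diff annihilates_mult by blast
    then have r: "annihilates r" by (simp add: qr(1) mult.commute)
    have "Mp r = 0"
    proof (rule ccontr)
      assume r0: "Mp r \<noteq> 0"
      then obtain c where c: "monic (Mp (smult c r))" "degree_m (smult c r) = degree_m r"
        using normalize_m[of r] by blast
      have "annihilates (Mp (smult c r))"
        using annihilates_cong[of "Mp (smult c r)" "smult c r"] annihilates_smult[OF r] by simp
      then have "degree P \<le> degree_m r" using min[of "Mp (smult c r)"] c by simp
      then show False using qr(2) degree_m_le[of r] r0 by auto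
    qed
    then have "f =m P * q" using qr(1) eq_m_add[of "P * q" "P * q" r 0] by simp
    then show ?thesis by (rule dvdmI)
  qed
  then show ?thesis using that P by blast
qed

text \<open>If \<open>p\<close> divides all \<open>w\<^sup>T A\<^sup>k w\<close>, then \<open>M\<^sup>*/M\<close> is \<open>F\<^sub>p[x]/(P\<^sup>2)\<close> locally at \<open>p\<close>, where
  \<open>P\<close> generates the annihilator of \<open>w\<close> modulo \<open>p\<close>; for \<open>p = 2\<close> a square divisible by \<open>P\<^sup>2\<close> is
  the square of a multiple of \<open>P\<close>.\<close>

lemma dvd_of_totally_isotropic:
  assumes iso: "\<And>k. p dvd act (monom 1 k) w \<bullet> w" and "p = 2"
    and u: "u \<in> carrier_vec n" "\<And>k. k < n \<Longrightarrow> p dvd moment u k"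
      "\<And>k. p ^ 2 dvd act (monom 1 k) u \<bullet> u"
    and i: "i < n"
  shows "p dvd u $ i"
proof -
  have iso': "p dvd act f w \<bullet> act g w" for f g
  proof -
    have "act f w \<bullet> act g w = act (g * f) w \<bullet> w"
      by (simp add: act_mult[OF w] act_adjoint[of "act f w" w g])
    then show ?thesis using act_poly_scalar_prod_dvd[of p w w "g * f"] iso by simp
  qed
  obtain P where P: "monic P" "annihilates P" "\<And>f. annihilates f \<Longrightarrow> P dvdm f"
    using monic_annihilator by blast
  have ann: "annihilates (dual_poly (moment b))" if b: "b \<in> carrier_vec n" for b
    unfolding annihilates_def
    by (rule bexI[of _ "d' \<cdot>\<^sub>v b"]) (use b in \<open>auto simp: act_dual_poly d smult_smult_assoc\<close>)
  \<comment> \<open>The tested vectors are \<open>d b\<close> for arbitrary integer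
    \<open>b\<close>. One factor \<open>p\<close> of \<open>p ^ 2\<close> is used up by
    \<open>d\<close>, and the other remains for \<open>b \<bullet> act g w\<close>.\<close>
  have cancel: "annihilates g"
    if "\<And>b. b \<in> carrier_vec n \<Longrightarrow> p ^ 2 dvd act (dual_poly (moment b)) w \<bullet> act g w" for g
  proof (rule annihilatesI)
    fix b :: "int vec" assume b: "b \<in> carrier_vec n"
    have "p ^ 2 dvd d * (b \<bullet> act g w)"
      using that[OF b] b by (simp add: act_dual_poly smult_scalar_prod_distrib[of _ n])
    then have "p * p dvd p * (d' * (b \<bullet> act g w))" by (simp add: d power2_eq_square mult.assoc)
    then have "p dvd d' * (b \<bullet> act g w)" using p_neq_0 by (simp only: dvd_mult_cancel_left) simp
    then show "p dvd b \<bullet> act g w" using d' prime by (simp add: prime_dvd_mult_iff)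
  qed
  \<comment> \<open>To see that the quotient \<open>a\<close> annihilates, write \<open>d b\<close>
    as a multiple \<open>P c\<close> of \<open>P\<close> applied to \<open>w\<close>, up to
    \<open>p\<close>, and move \<open>P\<close> to the other side: the pairing with \<open>a\<close>
    becomes the pairing of \<open>c\<close> with \<open>P a\<close>, that is, with \<open>g\<close>.
    By \<open>iso'\<close> every error term is \<open>p\<close> times a multiple of
    \<open>p\<close>.\<close>
  have step: "\<exists>a. g =m P * a \<and> annihilates a"
    if g: "annihilates g" "\<And>k. p ^ 2 dvd act (monom 1 k) w \<bullet> act g w" for g
  proof -
    obtain a where "g =m P * a" using P(3)[OF g(1)] by (auto simp: dvdm_def)
    then obtain r where r: "g = P * a + smult p r" using eq_m_imp_add_smult by blast
    have Pa: "p ^ 2 dvd act f w \<bullet> act (P * a) w" for f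
    proof -
      have "p ^ 2 dvd act f w \<bullet> act g w"
        using g(2) by (rule act_poly_scalar_prod_dvd) auto
      moreover have "act f w \<bullet> act g w
          = act f w \<bullet> act (P * a) w + p * (act f w \<bullet> act r w)"
        by (simp add: r act_add act_smult scalar_prod_add_distrib[of _ n] scalar_prod_smult_distrib[of _ n])
      moreover have "p ^ 2 dvd p * (act f w \<bullet> act r w)"
        using iso'[of f r] by (simp add: power2_eq_square)
      ultimately show ?thesis using dvd_add_left_iff by metis
    qed
    have "annihilates a"
    proof (rule cancel)
      fix b :: "int vec" assume b: "b \<in> carrier_vec n"
      obtain c where "dual_poly (moment b) =m P * c"
        using P(3)[OF ann[OF b]] by (auto simp: dvdm_def)
      then obtain s where "dual_poly (moment b) = P * c + smult p s"
        using eq_m_imp_add_smult by blast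
      then have "act (dual_poly (moment b)) w \<bullet> act a w
          = act (c * P) w \<bullet> act a w + p * (act s w \<bullet> act a w)"
        by (simp add: act_add act_smult add_scalar_prod_distrib[of _ n]
            smult_scalar_prod_distrib[of _ n] mult.commute[of P])
      moreover have "act (c * P) w \<bullet> act a w = act c w \<bullet> act (P * a) w"
      proof -
        have "act (c * P) w = act P (act c w)" by (simp add: act_mult act_commute[of w c])
        then show ?thesis by (simp add: act_mult act_adjoint)
      qed
      moreover have "p ^ 2 dvd p * (act s w \<bullet> act a w)"
        using iso'[of s a] by (simp add: power2_eq_square)
      ultimately show "p ^ 2 dvd act (dual_poly (moment b)) w \<bullet> act a w"
        using Pa[of c] by simp
    qed
    then show ?thesis using \<open>g =m P * a\<close> by blast
  qed
  obtain f where f: "act f w = d' \<cdot>\<^sub>v u" using obtain_representation[OF u(1,2)] by blast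
  have sq: "p ^ 2 dvd act (monom 1 k) w \<bullet> act (f ^ 2) w" for k
    using u by (intro moments_square_dvd[OF f]) auto
  have "annihilates (f ^ 2)"
  proof (rule cancel)
    show "p ^ 2 dvd act (dual_poly (moment b)) w \<bullet> act (f ^ 2) w" for b
      using sq by (rule act_poly_scalar_prod_dvd) auto
  qed
  then obtain a where a: "f ^ 2 =m P * a" "annihilates a" using step sq by blast
  have "P * P dvdm P * a" by (intro mult_dvdm_mono P(3) a(2))
  then have "P ^ 2 dvdm f ^ 2" using dvdm_cong[OF a(1)] by (simp add: power2_eq_square)
  then have "P dvdm f" by (rule square_dvdm_square_char_2[OF \<open>p = 2\<close> P(1)])
  then have "annihilates f" using P(2) annihilates_dvdm by blast
  then show ?thesis using f u(1) i by (rule dvd_of_annihilates)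
qed

end

section \<open>Parity of quadratic forms and of the moments of \<open>w\<close>\<close>

lemma even_sum_symmetric:
  fixes f :: "nat \<Rightarrow> nat \<Rightarrow> int"
  assumes "\<And>i j. i < n \<Longrightarrow> j < n \<Longrightarrow> f i j = f j i" "\<And>i. i < n \<Longrightarrow> even (f i i)"
  shows "even (\<Sum>i<n. \<Sum>j<n. f i j)"
  using assms
proof (induction n)
  case (Suc n)
  have "(\<Sum>i<n. f i n) = (\<Sum>i<n. f n i)" using Suc.prems by (intro sum.cong) auto
  then have "(\<Sum>i<Suc n. \<Sum>j<Suc n. f i j) = (\<Sum>i<n. \<Sum>j<n. f i j) + 2 * (\<Sum>i<n. f n i) + f n n"
    by (simp add: sum.distrib)
  then show ?case using Suc by simp
qed simp

lemma even_quadratic_form: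
  fixes A :: "int mat"
  assumes A: "A \<in> carrier_mat n n" "transpose_mat A = A" "\<And>i. i < n \<Longrightarrow> even (A $$ (i, i))"
    and x: "x \<in> carrier_vec n"
  shows "even (x \<bullet> (A *\<^sub>v x))"
proof -
  have "x \<bullet> (A *\<^sub>v x) = (\<Sum>i<n. \<Sum>j<n. x $ i * (A $$ (i, j) * x $ j))"
    using A(1) x by (simp add: scalar_prod_def atLeast0LessThan sum_distrib_left)
  moreover have "even (\<Sum>i<n. \<Sum>j<n. x $ i * (A $$ (i, j) * x $ j))"
  proof (rule even_sum_symmetric)
    fix i j assume "i < n" "j < n"
    then have "A $$ (i, j) = A $$ (j, i)" using A(1,2) by (metis carrier_matD index_transpose_mat(1))
    then show "x $ i * (A $$ (i, j) * x $ j) = x $ j * (A $$ (j, i) * x $ i)" by simp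
  qed (use A(3) in auto)
  ultimately show ?thesis by simp
qed

lemma (in cyclic_pair) d_dvd_phi: "d dvd phi f"
proof -
  have "monic \<chi>" by (simp add: char_poly_degree)
  then obtain q r where qr: "f = \<chi> * q + r" "r = 0 \<or> degree r < n"
    using monic_divmod[of \<chi> f] by (auto simp: char_poly_degree)
  have "phi f = phi (\<chi> * q + r)" by (simp add: qr(1))
  also have "\<dots> = phi r" using phi_diff[of "\<chi> * q + r" r] by (simp add: phi_char_poly)
  also have "\<dots> = d * coeff r (n - 1)"
    using qr(2) by (intro phi_low) (auto intro: coeff_eq_0)
  finally show ?thesis by simp
qed

text \<open>Modulo 2, \<open>x\<^sup>T x\<close> equals \<open>e\<^sup>T x\<close>, which vanishes on the \<open>A\<close>-invariant space spanned by \<open>w\<close>;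
  this settles even exponents, and odd ones use the zero diagonal.\<close>

lemma (in cyclic_pair) even_moments:
  assumes "even d" and e1: "\<And>i. i < n \<Longrightarrow> e $ i = 1" and diag: "\<And>i. i < n \<Longrightarrow> even (A $$ (i, i))"
  shows "even (act (monom 1 k) w \<bullet> w)"
proof -
  define x where "x = act (monom 1 (k div 2)) w"
  have x: "x \<in> carrier_vec n" by (simp add: x_def)
  show ?thesis
  proof (cases "even k")
    case True
    then have "monom (1 :: int) k = monom 1 (k div 2) * monom 1 (k div 2)"
      by (simp add: mult_monom flip: mult_2)
    then have "act (monom 1 k) w \<bullet> w = x \<bullet> x"
      by (simp add: x_def act_mult[OF w] act_adjoint[of _ w "monom 1 (k div 2)"])
    moreover have "even (x \<bullet> x - e \<bullet> x)"
    proof -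
      have "x \<bullet> x - e \<bullet> x = (\<Sum>i<n. x $ i * x $ i - x $ i)"
        using x by (simp add: scalar_prod_def atLeast0LessThan e1 sum_subtractf)
      also have "even \<dots>" by (intro dvd_sum) simp
      finally show ?thesis .
    qed
    moreover have "e \<bullet> x = phi (monom 1 (k div 2))"
      by (simp add: x_def phi_def act_adjoint)
    then have "even (e \<bullet> x)" using d_dvd_phi \<open>even d\<close> dvd_trans by metis
    ultimately show ?thesis by simp
  next
    case False
    define y :: "int poly" where "y = monom 1 (k div 2)"
    have "k = Suc (k div 2 + k div 2)" using False by presburger
    then have "monom (1 :: int) k = y * (pCons 0 1 * y)"
      using monom_Suc[of "1 :: int" "k div 2 + k div 2"]
      by (simp add: y_def mult_monom)
    then have "act (monom 1 k) w \<bullet> w = act (pCons 0 1 * y) w \<bullet> act y w"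
      using act_adjoint[of "act (pCons 0 1 * y) w" w y] by (simp only: act_mult[OF w] w act_closed)
    also have "act (pCons 0 1 * y) w = A *\<^sub>v x"
      by (simp add: x_def y_def act_pCons_0)
    also have "act y w = x" by (simp add: x_def y_def)
    also have "(A *\<^sub>v x) \<bullet> x = x \<bullet> (A *\<^sub>v x)"
      using x by (intro comm_scalar_prod[of _ n]) auto
    finally have "act (monom 1 k) w \<bullet> w = x \<bullet> (A *\<^sub>v x)" .
    then show ?thesis using even_quadratic_form[OF A sym diag x] by simp
  qed
qed

section \<open>The nullity modulo a prime\<close>

lemma vectorspace_kernel_mod:
  assumes p: "prime (p :: int)"
  shows "vectorspace (residue_ring p) (kernel_space_mod p M)"
proof -
  let ?K = "kernel_space_mod p M" and ?c = "dim_col M"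
  have p1: "1 < p" using p by (simp add: prime_gt_1_int)
  then have p0: "0 \<le> p" by simp
  interpret R: residues_prime "nat p" "residue_ring p"
    using p p1 by unfold_locales (simp_all add: prime_nat_iff_prime p0)
  have mod_closed: "map_vec (\<lambda>a. a mod p) v \<in> kernel_mod p M"
    if v: "v \<in> carrier_vec ?c" "\<And>i. i < dim_row M \<Longrightarrow> p dvd (M *\<^sub>v v) $ i" for v
  proof -
    have "(M *\<^sub>v map_vec (\<lambda>a. a mod p) v) $ i mod p = 0" if i: "i < dim_row M" for i
    proof -
      have "(M *\<^sub>v map_vec (\<lambda>a. a mod p) v) $ i mod p = (\<Sum>j = 0..<?c. M $$ (i, j) * (v $ j mod p)) mod p"
        using i v(1) by (simp add: scalar_prod_def)
      also have "\<dots> = (\<Sum>j = 0..<?c. (M $$ (i, j) * (v $ j mod p)) mod p) mod p"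
        by (simp only: mod_sum_eq)
      also have "\<dots> = (\<Sum>j = 0..<?c. (M $$ (i, j) * v $ j) mod p) mod p"
        by (simp only: mod_mult_right_eq)
      also have "\<dots> = (\<Sum>j = 0..<?c. M $$ (i, j) * v $ j) mod p"
        by (simp only: mod_sum_eq)
      also have "\<dots> = (M *\<^sub>v v) $ i mod p" using i v(1) by (simp add: scalar_prod_def)
      finally show ?thesis using v(2)[OF i] by simp
    qed
    then show ?thesis using v(1) p1 by (auto simp: kernel_mod_def)
  qed
  have M: "M \<in> carrier_mat (dim_row M) ?c" by auto
  have kD: "v \<in> carrier_vec ?c" "dim_vec v = ?c" "\<And>i. i < ?c \<Longrightarrow> v $ i mod p = v $ i"
    "\<And>i. i < dim_row M \<Longrightarrow> p dvd (M *\<^sub>v v) $ i" if "v \<in> kernel_mod p M" for v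
    using that by (auto simp: kernel_mod_def mod_eq_0_iff_dvd)
  have add_closed: "map_vec (\<lambda>a. a mod p) (v + w) \<in> kernel_mod p M"
    if "v \<in> kernel_mod p M" "w \<in> kernel_mod p M" for v w
    using kD[OF that(1)] kD[OF that(2)] by (intro mod_closed) (auto simp: mult_add_distrib_mat_vec[OF M])
  have smult_closed: "map_vec (\<lambda>a. a mod p) (c \<cdot>\<^sub>v v) \<in> kernel_mod p M"
    if "v \<in> kernel_mod p M" for c v
    using kD[OF that] by (intro mod_closed) (auto simp: smult_mult_mat_vec[OF M])
  have zero_closed: "0\<^sub>v ?c \<in> kernel_mod p M"
    using p1 by (auto simp: kernel_mod_def)
  have "abelian_group ?K"
  proof (rule abelian_groupI)
    fix x assume x: "x \<in> carrier ?K"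
    let ?y = "map_vec (\<lambda>a. a mod p) ((-1) \<cdot>\<^sub>v x)"
    have "?y \<in> carrier ?K" using x smult_closed by (simp add: kernel_space_mod_def)
    moreover have "?y \<oplus>\<^bsub>?K\<^esub> x = \<zero>\<^bsub>?K\<^esub>"
      using x by (auto simp: kernel_space_mod_def mod_simps dest!: kD intro!: eq_vecI)
    ultimately show "\<exists>y\<in>carrier ?K. y \<oplus>\<^bsub>?K\<^esub> x = \<zero>\<^bsub>?K\<^esub>" by blast
  qed (use add_closed zero_closed in
    \<open>auto simp: kernel_space_mod_def mod_simps ac_simps kD intro!: eq_vecI\<close>)
  moreover have "cring (residue_ring p)" by (rule R.cring)
  ultimately have "module (residue_ring p) ?K"
    by (intro moduleI) (use smult_closed in
      \<open>auto simp: kernel_space_mod_def residue_ring_def mod_simps algebra_simps kD intro!: eq_vecI\<close>)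
  moreover have "field (residue_ring p)" by (rule R.is_field)
  ultimately show ?thesis by (simp add: vectorspace_def)
qed

lemma finite_kernel_mod: "finite (kernel_mod p M)"
proof (rule finite_subset)
  show "kernel_mod p M \<subseteq> vec (dim_col M) ` (PiE {..<dim_col M} (\<lambda>_. {0..<p}))"
  proof
    fix v assume "v \<in> kernel_mod p M"
    then have "v = vec (dim_col M) (restrict (\<lambda>i. v $ i) {..<dim_col M})"
      and "restrict (\<lambda>i. v $ i) {..<dim_col M} \<in> PiE {..<dim_col M} (\<lambda>_. {0..<p})"
      by (auto simp: kernel_mod_def)
    then show "v \<in> vec (dim_col M) ` (PiE {..<dim_col M} (\<lambda>_. {0..<p}))" by blast
  qed
qed (simp add: finite_PiE)

text \<open>The abstract dimension is converted into a count, since every kernel vector is a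
  combination of a basis with coefficients from a set of size \<open>p\<close>. The upper bound
  suffices for the pigeonhole argument that follows.\<close>

lemma card_kernel_mod_le:
  assumes p: "prime (p :: int)"
  shows "card (kernel_mod p M) \<le> nat p ^ nullity_mod p M"
proof -
  let ?K = "kernel_space_mod p M" and ?R = "residue_ring p"
  interpret vectorspace ?R ?K by (rule vectorspace_kernel_mod[OF p])
  have carr: "carrier ?K = kernel_mod p M" by (simp add: kernel_space_mod_def)
  have "span (carrier ?K) = carrier ?K"
    using in_own_span[of "carrier ?K"] span_is_subset2[of "carrier ?K"] by blast
  then have fin_dim unfolding fin_dim_def using finite_kernel_mod carr by auto
  then obtain B where B: "finite B" "basis B" using finite_basis_exists by blast
  then have BV: "B \<subseteq> carrier ?K" "span B = carrier ?K" by (auto simp: basis_def)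
  have "carrier ?K \<subseteq> (\<lambda>a. lincomb a B) ` (PiE B (\<lambda>_. carrier ?R))"
  proof
    fix v assume "v \<in> carrier ?K"
    then obtain a where a: "a \<in> B \<rightarrow> carrier ?R" "v = lincomb a B"
      using finite_span[OF B(1) BV(1)] BV(2) by auto
    have "lincomb (restrict a B) B = lincomb a B"
      using a(1) BV(1) by (intro lincomb_cong) auto
    then show "v \<in> (\<lambda>a. lincomb a B) ` (PiE B (\<lambda>_. carrier ?R))"
      using a by (intro image_eqI[of _ _ "restrict a B"]) auto
  qed
  then have "card (carrier ?K) \<le> card (PiE B (\<lambda>_. carrier ?R))"
    using B(1) by (intro surj_card_le) (auto intro!: finite_PiE simp: residue_ring_def)
  also have "\<dots> = nat p ^ card B"
    using B(1) by (simp add: card_PiE residue_ring_def)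
  finally show ?thesis using dim_basis[OF B] carr by (simp add: nullity_mod_def)
qed

text \<open>Pigeonhole: there are \<open>p ^ (K + 1)\<close> reduced coefficient tuples of length
  \<open>K + 1\<close>, where \<open>K\<close> is the nullity, but at most \<open>p ^ K\<close>
  kernel vectors. The difference of two colliding tuples is the desired relation.\<close>

lemma kernel_mod_dependent:
  assumes p: "prime (p :: int)" and M: "M \<in> carrier_mat n n"
    and x: "\<And>k. x k \<in> carrier_vec n" "\<And>k i. i < n \<Longrightarrow> p dvd (M *\<^sub>v x k) $ i"
  obtains a :: "nat \<Rightarrow> int" where "\<exists>k \<le> nullity_mod p M. \<not> p dvd a k"
    and "\<And>i. i < n \<Longrightarrow> p dvd (\<Sum>k \<le> nullity_mod p M. a k * x k $ i)"
proof -
  let ?K = "nullity_mod p M"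
  let ?C = "PiE {..?K} (\<lambda>_. {0..<p})"
  let ?s = "\<lambda>c i. \<Sum>k \<le> ?K. c k * x k $ i"
  let ?f = "\<lambda>c. vec n (\<lambda>i. ?s c i mod p)"
  have p1: "1 < p" using p by (simp add: prime_gt_1_int)
  have f: "?f c \<in> kernel_mod p M" for c
  proof -
    have "(M *\<^sub>v ?f c) $ i mod p = 0" if i: "i < n" for i
    proof -
      have "(M *\<^sub>v ?f c) $ i mod p = (\<Sum>j<n. M $$ (i, j) * (?s c j mod p)) mod p"
        using i M by (simp add: scalar_prod_def atLeast0LessThan)
      also have "\<dots> = (\<Sum>j<n. (M $$ (i, j) * (?s c j mod p)) mod p) mod p"
        by (simp only: mod_sum_eq)
      also have "\<dots> = (\<Sum>j<n. (M $$ (i, j) * ?s c j) mod p) mod p"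
        by (simp only: mod_mult_right_eq)
      also have "\<dots> = (\<Sum>j<n. M $$ (i, j) * ?s c j) mod p"
        by (simp only: mod_sum_eq)
      also have "(\<Sum>j<n. M $$ (i, j) * ?s c j) = (\<Sum>j<n. \<Sum>k\<le>?K. c k * (M $$ (i, j) * x k $ j))"
        by (simp add: sum_distrib_left ac_simps)
      also have "\<dots> = (\<Sum>k\<le>?K. c k * (M *\<^sub>v x k) $ i)"
      proof -
        have "(M *\<^sub>v x k) $ i = (\<Sum>j<n. M $$ (i, j) * x k $ j)" for k
          using i M x(1)[of k] by (auto simp: scalar_prod_def atLeast0LessThan intro!: sum.cong)
        then show ?thesis by (subst sum.swap) (simp add: sum_distrib_left)
      qed
      also have "\<dots> mod p = 0"
        using x(2)[OF i] by (simp add: dvd_sum)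
      finally show ?thesis .
    qed
    then show ?thesis using M p1 by (auto simp: kernel_mod_def)
  qed
  have "\<not> inj_on ?f ?C"
  proof
    assume "inj_on ?f ?C"
    then have "card ?C \<le> card (kernel_mod p M)"
      using f finite_kernel_mod by (intro card_inj_on_le) auto
    also have "\<dots> \<le> nat p ^ ?K" by (rule card_kernel_mod_le[OF p])
    also have "\<dots> < nat p ^ Suc ?K" using p1 by simp
    also have "\<dots> = card ?C" by (simp add: card_PiE)
    finally show False by simp
  qed
  then obtain c c' where c: "c \<in> ?C" "c' \<in> ?C" "?f c = ?f c'" "c \<noteq> c'"
    by (auto simp: inj_on_def)
  then obtain k where k: "c k \<noteq> c' k" by blast
  then have kK: "k \<le> ?K" using c(1,2) by (metis PiE_arb atMost_iff)
  have "\<not> p dvd c k - c' k"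
  proof
    assume "p dvd c k - c' k"
    then have "c k mod p = c' k mod p" by (simp add: mod_eq_dvd_iff)
    moreover have "c k \<in> {0..<p}" "c' k \<in> {0..<p}" using c(1,2) kK by auto
    ultimately show False using k by simp
  qed
  moreover have "p dvd (\<Sum>k\<le>?K. (c k - c' k) * x k $ i)" if i: "i < n" for i
  proof -
    have "?f c $ i = ?f c' $ i" using c(3) by simp
    then have "p dvd ?s c i - ?s c' i" using i by (simp add: mod_eq_dvd_iff)
    then show ?thesis by (simp add: sum_subtractf left_diff_distrib)
  qed
  ultimately show ?thesis using kK by (intro that[of "\<lambda>k. c k - c' k"]) auto
qed

section \<open>Characteristic polynomials and walk counts\<close>

lemma (in square_mat) act_zero_vec: "act f (0\<^sub>v n) = 0\<^sub>v n"
proof -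
  have "act f (0 \<cdot>\<^sub>v 0\<^sub>v n) = 0 \<cdot>\<^sub>v act f (0\<^sub>v n)" by (rule act_vec_smult) simp
  moreover have "0 \<cdot>\<^sub>v v = 0\<^sub>v n" if "v \<in> carrier_vec n" for v :: "'a vec"
    using that by (intro eq_vecI) auto
  ultimately show ?thesis by simp
qed

text \<open>The rank-one update formula is applied with \<open>z = adj (xI - A) e\<close>, whose
  coefficients are Horner shifts of \<open>\<chi>\<close>. The scalar \<open>c\<close> is -1 for
  \<open>A + J\<close> and 1 for the complement.\<close>

lemma det_char_poly_matrix_add_outer:
  fixes A :: "int mat"
  assumes A: "A \<in> carrier_mat n n" and e: "e \<in> carrier_vec n"
  shows "det (mat n n (\<lambda>(i, j). char_poly_matrix A $$ (i, j) + [:c * e $ i * e $ j:]))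
    = char_poly A + smult c (\<Sum>m<n. smult (mat_poly_act A (monom 1 m) e \<bullet> e) (poly_shift (Suc m) (char_poly A)))"
proof -
  interpret square_mat A n by unfold_locales (rule A)
  let ?\<chi> = "char_poly A" and ?C = "char_poly_matrix A"
  have \<chi>: "degree ?\<chi> = n" "coeff ?\<chi> n = 1" using degree_monic_char_poly[OF A] by auto
  obtain z where z: "z \<in> carrier_vec n" "?C *\<^sub>v z = ?\<chi> \<cdot>\<^sub>v map_vec (\<lambda>a. [:a:]) e"
    and zc: "\<And>j r. r < n \<Longrightarrow> coeff (z $ r) j = act (poly_shift (Suc j) ?\<chi>) e $ r"
    using adj_char_poly_matrix[OF e] by metis
  let ?e = "map_vec (\<lambda>a. [:a:]) e"
  have C: "?C \<in> carrier_mat n n" using A by (rule char_poly_matrix_closed)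
  have Cz: "?C *\<^sub>v ([:c:] \<cdot>\<^sub>v z) = det ?C \<cdot>\<^sub>v ([:c:] \<cdot>\<^sub>v ?e)"
    using smult_mult_mat_vec[OF C z(1)] z(2)
    by (simp add: smult_smult_assoc mult.commute char_poly_def)
  have d0: "det ?C \<noteq> 0" using \<chi> by (auto simp: char_poly_def)
  have "mat n n (\<lambda>(i, j). ?C $$ (i, j) + [:c * e $ i * e $ j:])
      = mat n n (\<lambda>(i, j). ?C $$ (i, j) + ([:c:] \<cdot>\<^sub>v ?e) $ i * ?e $ j)"
    using e by (intro cong_mat) auto
  also have "det \<dots> = det ?C + ?e \<bullet> ([:c:] \<cdot>\<^sub>v z)"
    using e z d0 by (intro det_add_outer_product[OF C _ _ _ Cz]) auto
  also have "?e \<bullet> ([:c:] \<cdot>\<^sub>v z) = smult c (?e \<bullet> z)"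
    using e z by (simp add: scalar_prod_smult_distrib[of _ n])
  also have "?e \<bullet> z = (\<Sum>m<n. smult (act (monom 1 m) e \<bullet> e) (poly_shift (Suc m) ?\<chi>))"
  proof (rule poly_eqI)
    fix j
    have "coeff (?e \<bullet> z) j = (\<Sum>r<n. e $ r * coeff (z $ r) j)"
      using e z by (simp add: scalar_prod_def atLeast0LessThan coeff_sum)
    also have "\<dots> = act (poly_shift (Suc j) ?\<chi>) e \<bullet> e"
      using e by (simp add: zc scalar_prod_def atLeast0LessThan mult.commute)
    also have "\<dots> = (\<Sum>m<n. coeff (poly_shift (Suc j) ?\<chi>) m * (act (monom 1 m) e \<bullet> e))"
      using e \<chi> by (intro act_scalar_prod_sum) (auto simp: coeff_poly_shift intro!: coeff_eq_0)
    finally show "coeff (?e \<bullet> z) j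
        = coeff (\<Sum>m<n. smult (act (monom 1 m) e \<bullet> e) (poly_shift (Suc m) ?\<chi>)) j"
      by (simp add: coeff_sum coeff_poly_shift ac_simps)
  qed
  finally show ?thesis by (simp add: char_poly_def)
qed

text \<open>This is \<open>e\<^sup>T adj (xI - A) e\<close>, the numerator over
  \<open>\<chi>\<close> of the generating function of the walk counts
  \<open>e\<^sup>T A\<^sup>k e\<close>.\<close>

definition walk_numerator :: "nat \<Rightarrow> int mat \<Rightarrow> int poly" where
  "walk_numerator n A = (\<Sum>m<n. smult (mat_poly_act A (monom 1 m) (all_ones_vec n) \<bullet> all_ones_vec n)
      (poly_shift (Suc m) (char_poly A)))"

lemma char_poly_add_all_ones:
  assumes A: "A \<in> carrier_mat n n"
  shows "char_poly (A + all_ones_mat n) = char_poly A - walk_numerator n A"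
proof -
  have "char_poly_matrix (A + all_ones_mat n)
      = mat n n (\<lambda>(i, j). char_poly_matrix A $$ (i, j)
          + [:(-1) * all_ones_vec n $ i * all_ones_vec n $ j:])"
    using A by (intro eq_matI) (auto simp: char_poly_matrix_def all_ones_mat_def all_ones_vec_def)
  then show ?thesis
    using det_char_poly_matrix_add_outer[OF A, of "all_ones_vec n" "-1"]
    by (simp add: char_poly_def[of "A + all_ones_mat n"] walk_numerator_def all_ones_vec_def)
qed

text \<open>With \<open>y = -1 - x\<close>, the matrix \<open>xI - (J - I - A)\<close> equals
  \<open>-(yI - A + J)\<close>. Substituting \<open>y\<close> is a ring homomorphism and therefore
  commutes with the determinant.\<close>

lemma char_poly_complement:
  assumes A: "A \<in> carrier_mat n n"
  shows "char_poly (all_ones_mat n - 1\<^sub>m n - A)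
    = (-1) ^ n * ((char_poly A + walk_numerator n A) \<circ>\<^sub>p [:-1, -1:])"
proof -
  let ?B = "mat n n (\<lambda>(i, j). char_poly_matrix A $$ (i, j)
          + [:1 * all_ones_vec n $ i * all_ones_vec n $ j:])"
  have hom: "comm_ring_hom (\<lambda>p :: int poly. p \<circ>\<^sub>p [:-1, -1:])"
    by unfold_locales (auto simp: pcompose_add pcompose_mult pcompose_1)
  have "char_poly_matrix (all_ones_mat n - 1\<^sub>m n - A)
      = (-1) \<cdot>\<^sub>m map_mat (\<lambda>p. p \<circ>\<^sub>p [:-1, -1:]) ?B"
    using A by (intro eq_matI)
      (auto simp: char_poly_matrix_def all_ones_mat_def all_ones_vec_def pcompose_pCons pcompose_add)
  then have "char_poly (all_ones_mat n - 1\<^sub>m n - A) = (-1) ^ n * (det ?B \<circ>\<^sub>p [:-1, -1:])"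
    by (simp add: char_poly_def det_smult flip: comm_ring_hom.hom_det[OF hom])
  also have "det ?B = char_poly A + walk_numerator n A"
    using det_char_poly_matrix_add_outer[OF A, of "all_ones_vec n" 1]
    by (simp add: walk_numerator_def all_ones_vec_def)
  finally show ?thesis .
qed

text \<open>The substitution \<open>x \<mapsto> -1 - x\<close> is an involution, so both numerators
  agree. Their coefficients depend on the first \<open>n\<close> walk counts through a triangular
  system with unit diagonal, as \<open>\<chi>\<close> is monic; all further counts follow by
  reduction modulo \<open>\<chi>\<close>.\<close>

lemma moments_eq:
  assumes A: "A \<in> carrier_mat n n" and B: "B \<in> carrier_mat n n"
    and \<chi>: "char_poly A = char_poly B"
    and "char_poly (all_ones_mat n - 1\<^sub>m n - A) = char_poly (all_ones_mat n - 1\<^sub>m n - B)"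
  shows "mat_poly_act A f (all_ones_vec n) \<bullet> all_ones_vec n
    = mat_poly_act B f (all_ones_vec n) \<bullet> all_ones_vec n"
proof -
  interpret A: square_mat A n by unfold_locales (rule A)
  interpret B: square_mat B n by unfold_locales (rule B)
  let ?e = "all_ones_vec n" and ?\<chi> = "char_poly A"
  have e: "?e \<in> carrier_vec n" by (simp add: all_ones_vec_def)
  define a where "a k = A.act (monom 1 k) ?e \<bullet> ?e" for k
  define b where "b k = B.act (monom 1 k) ?e \<bullet> ?e" for k
  have deg: "degree ?\<chi> = n" "coeff ?\<chi> n = 1" using degree_monic_char_poly[OF A] by auto
  let ?l = "[:-1, -1:] :: int poly"
  have "(char_poly A + walk_numerator n A) \<circ>\<^sub>p ?l = (char_poly B + walk_numerator n B) \<circ>\<^sub>p ?l"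
    using assms(4) by (simp add: char_poly_complement A B)
  then have "((char_poly A + walk_numerator n A) \<circ>\<^sub>p ?l) \<circ>\<^sub>p ?l = ((char_poly B + walk_numerator n B) \<circ>\<^sub>p ?l) \<circ>\<^sub>p ?l"
    by simp
  moreover have "(f \<circ>\<^sub>p ?l) \<circ>\<^sub>p ?l = f" for f
    by (simp add: pcompose_assoc[symmetric] pcompose_pCons pcompose_idR[simplified])
  ultimately have walk: "walk_numerator n A = walk_numerator n B" using \<chi> by simp
  have coeff_walk: "coeff (walk_numerator n A) j = (\<Sum>m<n. a m * coeff ?\<chi> (j + Suc m))"
    "coeff (walk_numerator n B) j = (\<Sum>m<n. b m * coeff ?\<chi> (j + Suc m))" for j
    by (simp_all add: walk_numerator_def coeff_sum coeff_poly_shift a_def b_def \<chi>)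
  have low: "a k = b k" if "k < n" for k
    using that
  proof (induction k rule: less_induct)
    case (less k)
    \<comment> \<open>At the coefficient index \<open>n - Suc k\<close>, terms with
      \<open>m < k\<close> vanish by induction and those with \<open>m > k\<close> by the degree of
      \<open>\<chi>\<close>; the term \<open>m = k\<close> carries its leading coefficient.\<close>
    have "(\<Sum>m<n. (a m - b m) * coeff ?\<chi> (n - Suc k + Suc m)) = 0"
      using walk coeff_walk[of "n - Suc k"] by (simp add: left_diff_distrib sum_subtractf)
    moreover have "(a m - b m) * coeff ?\<chi> (n - Suc k + Suc m) = (if m = k then a k - b k else 0)"
      if "m < n" for m
    proof (cases m k rule: linorder_cases)
      case less
      then show ?thesis using less.IH that by simp
    next
      case equal
      have "n - Suc k + Suc m = n" using less.prems equal by simp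
      then show ?thesis using equal deg by simp
    next
      case greater
      then have "coeff ?\<chi> (n - Suc k + Suc m) = 0"
        using deg less.prems by (intro coeff_eq_0) simp
      then show ?thesis using greater by simp
    qed
    ultimately show ?case using less.prems by (simp cong: sum.cong_simp)
  qed
  have "monic ?\<chi>" by (simp add: deg)
  then obtain q r where qr: "f = q * ?\<chi> + r" "r = 0 \<or> degree r < n"
    using monic_divmod[of ?\<chi> f] by (auto simp: deg mult.commute)
  have r0: "coeff r i = 0" if "n \<le> i" for i
    using qr(2) that by (auto intro: coeff_eq_0)
  have "A.act f ?e \<bullet> ?e = A.act r ?e \<bullet> ?e"
    using e by (simp add: qr(1) A.act_add A.act_mult A.act_char_poly A.act_zero_vec)
  also have "\<dots> = B.act r ?e \<bullet> ?e"
    using A.act_scalar_prod_sum[OF e e r0] B.act_scalar_prod_sum[OF e e r0] low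
    by (simp add: a_def b_def)
  also have "\<dots> = B.act f ?e \<bullet> ?e"
    using e by (simp add: qr(1) \<chi> B.act_add B.act_mult B.act_char_poly B.act_zero_vec)
  finally show ?thesis .
qed

section \<open>Integer matrices\<close>

lemma squarefree_dvd_if_primes_dvd:
  fixes d x :: int
  assumes "squarefree d" and "\<And>p. prime p \<Longrightarrow> p dvd d \<Longrightarrow> p dvd x"
  shows "d dvd x"
proof -
  define g where "g = gcd d x"
  then have "g dvd d" by simp
  then obtain h where h: "d = g * h" by (elim dvdE)
  have "is_unit h"
  proof (rule ccontr)
    assume "\<not> is_unit h"
    moreover have "h \<noteq> 0" using h assms(1) by auto
    ultimately obtain p where p: "prime p" "p dvd h" using prime_divisor_exists by blast
    then have "p dvd d" by (simp add: h)
    then have "p dvd g" using assms(2)[OF p(1)] by (simp add: g_def)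
    then have "p * p dvd g * h" using p(2) by (rule mult_dvd_mono)
    then have "p * p dvd d" by (simp add: h)
    then have "is_unit p" using squarefreeD[OF assms(1), of p] by (simp only: power2_eq_square)
    then show False using p(1) not_prime_unit by blast
  qed
  then have "d dvd g" unfolding h by (simp only: mult_unit_dvd_iff dvd_refl)
  moreover have "g dvd x" by (simp add: g_def)
  ultimately show ?thesis by (rule dvd_trans)
qed

text \<open>The sizes \<open>n\<close> and \<open>m\<close> may differ: the degree of the common
  polynomial later shows that the mate has equally many vertices.\<close>

lemma char_poly_eq_if_mat_spectrum_eq:
  assumes A: "A \<in> carrier_mat n n" and B: "B \<in> carrier_mat m m" and eq: "mat_spectrum A = mat_spectrum B"
  shows "char_poly A = char_poly B"
proof -
  let ?c = "map_poly (of_int :: int \<Rightarrow> complex)"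
  have dec: "?c (char_poly C) = (\<Prod>x\<in>#mat_spectrum C. [:- x, 1:])"
    if C: "C \<in> carrier_mat k k" for C k
  proof -
    have hom: "char_poly (map_mat of_int C) = ?c (char_poly C)"
      by (rule of_int_hom.char_poly_hom[OF C])
    moreover have "lead_coeff (?c (char_poly C)) = 1"
      using degree_monic_char_poly[OF C] by simp
    ultimately show ?thesis
      using complex_poly_decompose_multiset[of "?c (char_poly C)"] by (simp add: mat_spectrum_def)
  qed
  have "?c (char_poly A) = ?c (char_poly B)" using dec[OF A] dec[OF B] eq by simp
  then show ?thesis by simp
qed

lemma unimodular_inverse:
  fixes U :: "int mat"
  assumes U: "U \<in> carrier_mat n n" and "\<bar>det U\<bar> = 1"
  obtains U' where "U' \<in> carrier_mat n n" "U * U' = 1\<^sub>m n" "U' * U = 1\<^sub>m n"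
proof
  let ?U = "det U \<cdot>\<^sub>m adj_mat U"
  have d: "det U * det U = 1" using assms(2) by (cases "det U \<ge> 0") auto
  note adj = adj_mat[OF U]
  show "?U \<in> carrier_mat n n" using adj(1) by simp
  show "U * ?U = 1\<^sub>m n"
    using mult_smult_distrib[OF U adj(1)] adj(2) d by (auto simp flip: mult.assoc intro!: eq_matI)
  show "?U * U = 1\<^sub>m n"
    using mult_smult_assoc_mat[OF adj(1) U] adj(3) d by (auto simp flip: mult.assoc intro!: eq_matI)
qed

text \<open>\<open>X\<close> is \<open>last ds\<close> times the inverse of \<open>M\<close>,
  integral because every invariant factor divides the last. The diagonal form equals its own
  transpose, which makes \<open>M\<close> and its transpose equivalent; \<open>R\<close> and
  \<open>K\<close> record this equivalence, so that kernel vectors of the transpose modulo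
  \<open>p\<close> can be carried to kernel vectors of \<open>M\<close>.\<close>

lemma smith_normal_formE:
  assumes snf: "smith_normal_form M ds" and M: "M \<in> carrier_mat n n" and n: "0 < n"
  obtains X R R' K where "0 < last ds"
    and "X \<in> carrier_mat n n" "M * X = last ds \<cdot>\<^sub>m 1\<^sub>m n" "X * M = last ds \<cdot>\<^sub>m 1\<^sub>m n"
    and "R \<in> carrier_mat n n" "R' \<in> carrier_mat n n" "K \<in> carrier_mat n n"
    and "R' * R = 1\<^sub>m n" "M * R = K * transpose_mat M"
proof -
  have "dim_row M = n" using M by simp
  then obtain U V where len: "length ds = n" and pos: "\<And>i. i < n \<Longrightarrow> 0 < ds ! i"
    and dvd: "\<And>i. Suc i < n \<Longrightarrow> ds ! i dvd ds ! Suc i"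
    and U: "U \<in> carrier_mat n n" "\<bar>det U\<bar> = 1" and V: "V \<in> carrier_mat n n" "\<bar>det V\<bar> = 1"
    and D: "U * M * V = mat_diag n (\<lambda>i. ds ! i)"
    using snf unfolding smith_normal_form_def Let_def by blast
  obtain U' where U': "U' \<in> carrier_mat n n" "U * U' = 1\<^sub>m n" "U' * U = 1\<^sub>m n"
    using unimodular_inverse[OF U] by blast
  obtain V' where V': "V' \<in> carrier_mat n n" "V * V' = 1\<^sub>m n" "V' * V = 1\<^sub>m n"
    using unimodular_inverse[OF V] by blast
  let ?d = "last ds" and ?D = "mat_diag n (\<lambda>i. ds ! i)"
  have last: "?d = ds ! (n - 1)" using len n by (cases ds) (auto simp: last_conv_nth)
  have "ds ! i dvd ds ! j" if "i \<le> j" "j < n" for i j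
    using that by (induction j rule: dec_induct) (auto intro: dvd_trans[OF _ dvd])
  then have dvd_last: "ds ! i dvd ?d" if "i < n" for i using that last by simp
  define E where "E = mat_diag n (\<lambda>i. ?d div ds ! i)"
  have E: "E \<in> carrier_mat n n" and Dc: "?D \<in> carrier_mat n n" by (auto simp: E_def)
  have DE: "?D * E = ?d \<cdot>\<^sub>m 1\<^sub>m n" "E * ?D = ?d \<cdot>\<^sub>m 1\<^sub>m n"
    unfolding E_def mat_diag_diag using dvd_last by (auto simp: mat_diag_def intro!: eq_matI)
  have MV: "M * V = U' * ?D"
  proof -
    have "U' * ?D = (U' * U) * (M * V)"
      using U(1) U'(1) V(1) M by (simp add: assoc_mult_mat[of _ n n _ n _ n] flip: D)
    also have "\<dots> = M * V" unfolding U'(3) using V M by simp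
    finally show ?thesis by simp
  qed
  have UM: "U * M = ?D * V'"
  proof -
    have "?D * V' = (U * M) * (V * V')"
      using U(1) V'(1) V(1) M by (simp add: assoc_mult_mat[of _ n n _ n _ n] flip: D)
    also have "\<dots> = U * M" unfolding V'(2) using U M by simp
    finally show ?thesis by simp
  qed
  let ?X = "V * (E * U)"
  have scal: "(?d \<cdot>\<^sub>m 1\<^sub>m n) * Y = ?d \<cdot>\<^sub>m Y" "Y * (?d \<cdot>\<^sub>m 1\<^sub>m n) = ?d \<cdot>\<^sub>m Y"
    if "Y \<in> carrier_mat n n" for Y :: "int mat"
    using that mult_smult_assoc_mat[of "1\<^sub>m n" n n Y n ?d] mult_smult_distrib[of Y n n "1\<^sub>m n" n ?d]
    by auto
  have "M * ?X = (M * V) * (E * U)" using M V E U by (simp add: assoc_mult_mat[of _ n n _ n _ n])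
  also have "\<dots> = U' * ((?D * E) * U)" unfolding MV
    using U' E U Dc by (simp add: assoc_mult_mat[of _ n n _ n _ n])
  also have "\<dots> = ?d \<cdot>\<^sub>m (U' * U)"
    using U U' by (simp add: DE scal mult_smult_distrib[of _ n n _ n])
  finally have 1: "M * ?X = ?d \<cdot>\<^sub>m 1\<^sub>m n" by (simp add: U')
  have "?X * M = V * (E * (U * M))" using M V E U by (simp add: assoc_mult_mat[of _ n n _ n _ n])
  also have "\<dots> = V * ((E * ?D) * V')" unfolding UM
    using V' E V Dc by (simp add: assoc_mult_mat[of _ n n _ n _ n])
  also have "\<dots> = ?d \<cdot>\<^sub>m (V * V')"
    using V V' by (simp add: DE scal mult_smult_distrib[of _ n n _ n])
  finally have 2: "?X * M = ?d \<cdot>\<^sub>m 1\<^sub>m n" by (simp add: V')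
  let ?R = "V * transpose_mat U'" and ?R' = "transpose_mat U * V'"
  let ?K = "U' * transpose_mat V"
  have tU: "transpose_mat U * transpose_mat U' = 1\<^sub>m n"
    using transpose_mult[OF U'(1) U(1)] U' by simp
  have "?R' * ?R = transpose_mat U * ((V' * V) * transpose_mat U')"
    using U(1) U'(1) V(1) V'(1) by (simp add: assoc_mult_mat[of _ n n _ n _ n])
  also have "\<dots> = 1\<^sub>m n" unfolding V'(3) using U' tU by simp
  finally have 3: "?R' * ?R = 1\<^sub>m n" .
  have Dt: "?D = transpose_mat V * (transpose_mat M * transpose_mat U)"
  proof -
    have "?D = transpose_mat ?D" by (intro eq_matI) (auto simp: mat_diag_def)
    also have "transpose_mat ?D = transpose_mat V * transpose_mat (U * M)"
      using transpose_mult[of "U * M" n n V n] U M V by (simp flip: D)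
    finally show ?thesis using transpose_mult[OF U(1) M] by simp
  qed
  have "M * ?R = (M * V) * transpose_mat U'" using M V U' by (simp add: assoc_mult_mat[of _ n n _ n _ n])
  also have "\<dots> = U' * (?D * transpose_mat U')" unfolding MV
    using U' Dc by (simp add: assoc_mult_mat[of _ n n _ n _ n])
  also have "?D * transpose_mat U'
      = transpose_mat V * (transpose_mat M * (transpose_mat U * transpose_mat U'))"
    unfolding Dt using U' U V M by (simp add: assoc_mult_mat[of _ n n _ n _ n])
  also have "U' * \<dots> = ?K * transpose_mat M"
    using U' V M by (simp add: tU assoc_mult_mat[of _ n n _ n _ n])
  finally have 4: "M * ?R = ?K * transpose_mat M" .
  show ?thesis
    by (rule that[of ?X ?R ?R' ?K]) (use 1 2 3 4 U U' V V' E pos[of "n - 1"] last n in auto)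
qed

text \<open>For integers \<open>x * x \<ge> x\<close>, with equality only at 0 and 1. Equal sums
  force equality in every entry, and the sum 1 leaves exactly one entry 1.\<close>

lemma unit_vec_if_sums_1:
  fixes q :: "int vec"
  assumes q: "q \<in> carrier_vec n" and "(\<Sum>i<n. q $ i) = 1" "(\<Sum>i<n. q $ i * q $ i) = 1"
  obtains i where "i < n" "q = unit_vec n i"
proof -
  have nonneg: "0 \<le> x * x - x" for x :: int
    using mult_nonneg_nonneg[of x "x - 1"] mult_nonpos_nonpos[of x "x - 1"]
    by (cases "1 \<le> x") (auto simp: algebra_simps)
  have "(\<Sum>i<n. q $ i * q $ i - q $ i) = 0" using assms by (simp add: sum_subtractf)
  then have z: "q $ i * q $ i - q $ i = 0" if "i < n" for i
    using sum_nonneg_eq_0_iff[of "{..<n}" "\<lambda>i. q $ i * q $ i - q $ i"] nonneg that by simp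
  then have q01: "q $ i = 0 \<or> q $ i = 1" if "i < n" for i
    using z[OF that] by (metis eq_iff_diff_eq_0 mult_cancel_left1 mult.commute)
  have "\<exists>i<n. q $ i = 1"
  proof (rule ccontr)
    assume "\<not> (\<exists>i<n. q $ i = 1)"
    then have "(\<Sum>i<n. q $ i) = 0" using q01 by (intro sum.neutral) auto
    then show False using assms(2) by simp
  qed
  then obtain i where i: "i < n" "q $ i = 1" by blast
  have "(\<Sum>j\<in>{..<n} - {i}. q $ j) = 0" using assms(2) i by (simp add: sum.remove[of _ i])
  then have "q $ j = 0" if "j < n" "j \<noteq> i" for j
    using sum_nonneg_eq_0_iff[of "{..<n} - {i}" "\<lambda>i. q $ i"] q01 that by fastforce
  then have "q = unit_vec n i" using q i by (intro eq_vecI) (auto simp: unit_vec_def)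
  then show ?thesis using i that by blast
qed

section \<open>Adjacency and walk matrices\<close>

lemma all_ones_vec_carrier [simp]: "all_ones_vec n \<in> carrier_vec n"
  by (simp add: all_ones_vec_def)

locale graph_matrix =
  fixes n :: nat and G :: "nat pair_pre_digraph"
  assumes graph_on: "graph_on n G"
begin

abbreviation A :: "int mat" where "A \<equiv> adjacency_matrix n G"
abbreviation W :: "int mat" where "W \<equiv> walk_matrix n G"
abbreviation e :: "int vec" where "e \<equiv> all_ones_vec n"

lemma pair_graph: "pair_graph G" and pverts: "pverts G = {0..<n}"
  using graph_on by (auto simp: graph_on_def)

lemma arcs_less: "(i, j) \<in> parcs G \<Longrightarrow> i < n \<and> j < n"
proof -
  interpret pair_graph G by (rule pair_graph)
  show "(i, j) \<in> parcs G \<Longrightarrow> i < n \<and> j < n"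
    using in_arcsD1[of i j] in_arcsD2[of i j] by (simp add: pverts)
qed

lemma arcs_sym: "(i, j) \<in> parcs G \<longleftrightarrow> (j, i) \<in> parcs G"
proof -
  interpret pair_graph G by (rule pair_graph)
  show ?thesis using arcs_symmetric by blast
qed

lemma arcs_irrefl: "(i, i) \<notin> parcs G"
proof -
  interpret pair_graph G by (rule pair_graph)
  show ?thesis using no_loops' by blast
qed

sublocale square_mat A n
  by unfold_locales (simp add: adjacency_matrix_def)

lemma A_sym: "transpose_mat A = A"
  by (intro eq_matI) (auto simp: adjacency_matrix_def arcs_sym)

lemma A_diag: "i < n \<Longrightarrow> A $$ (i, i) = 0"
  by (simp add: adjacency_matrix_def arcs_irrefl)

lemma adjacency_complement:
  "adjacency_matrix n (graph_complement G) = all_ones_mat n - 1\<^sub>m n - A"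
  by (intro eq_matI) (auto simp: adjacency_matrix_def graph_complement_def all_ones_mat_def pverts arcs_irrefl)

lemma W_carrier: "W \<in> carrier_mat n n"
  using mat_of_cols_carrier(1)[of n "map (\<lambda>k. A ^\<^sub>m k *\<^sub>v e) [0..<n]"] by (simp add: walk_matrix_def)

lemma col_W: "k < n \<Longrightarrow> col W k = act (monom 1 k) e"
  using col_mat_of_cols[of k "map (\<lambda>k. A ^\<^sub>m k *\<^sub>v e) [0..<n]" n] act_closed[of e "monom 1 k"]
  by (simp add: walk_matrix_def act_monom)

lemma transpose_W_mult:
  assumes "v \<in> carrier_vec n"
  shows "transpose_mat W *\<^sub>v v = vec n (\<lambda>k. act (monom 1 k) e \<bullet> v)"
  using assms W_carrier by (intro eq_vecI) (auto simp: col_W)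

end

section \<open>Cospectral and isomorphic graphs\<close>

lemma cospectral_char_poly_eq:
  assumes "graph_on n G" "graph_on m H" "generalized_spectrum m H = generalized_spectrum n G"
  shows "m = n" "char_poly (adjacency_matrix n H) = char_poly (adjacency_matrix n G)"
    "char_poly (all_ones_mat n - 1\<^sub>m n - adjacency_matrix n H)
      = char_poly (all_ones_mat n - 1\<^sub>m n - adjacency_matrix n G)"
proof -
  interpret G: graph_matrix n G by unfold_locales fact
  interpret H: graph_matrix m H by unfold_locales fact
  have 1: "char_poly H.A = char_poly G.A"
    using assms(3) by (intro char_poly_eq_if_mat_spectrum_eq[OF H.A G.A]) (simp add: generalized_spectrum_def)
  then show mn: "m = n"
    using degree_monic_char_poly[OF H.A] degree_monic_char_poly[OF G.A] by simp
  then show "char_poly (adjacency_matrix n H) = char_poly G.A" using 1 by simp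
  have c: "adjacency_matrix n (graph_complement F) \<in> carrier_mat n n" for F
    by (simp add: adjacency_matrix_def)
  have "char_poly (adjacency_matrix n (graph_complement H)) = char_poly (adjacency_matrix n (graph_complement G))"
    using assms(3) by (intro char_poly_eq_if_mat_spectrum_eq[OF c c]) (simp add: generalized_spectrum_def mn)
  then show "char_poly (all_ones_mat n - 1\<^sub>m n - adjacency_matrix n H)
      = char_poly (all_ones_mat n - 1\<^sub>m n - G.A)"
    using H.adjacency_complement by (simp add: G.adjacency_complement mn)
qed

lemma digraph_isoI:
  assumes G: "graph_on n G" and H: "graph_on n H"
    and s: "\<And>i. i < n \<Longrightarrow> s i < n" "inj_on s {..<n}"
    and arcs: "\<And>i j. i < n \<Longrightarrow> j < n \<Longrightarrow> (i, j) \<in> parcs H \<longleftrightarrow> (s i, s j) \<in> parcs G"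
  shows "digraph_iso (with_proj H) (with_proj G)"
proof -
  interpret G: graph_matrix n G by unfold_locales (rule G)
  interpret H: graph_matrix n H by unfold_locales (rule H)
  interpret HG: pair_graph H by (rule H.pair_graph)
  let ?f = "\<lparr>iso_verts = s, iso_arcs = map_prod s s, iso_head = snd, iso_tail = fst\<rparr>"
  have s_img: "s ` {0..<n} = {0..<n}"
    using s by (intro endo_inj_surj) (auto simp: atLeast0LessThan)
  have "inj_on (map_prod s s) (parcs H)"
    using H.arcs_less s(2) by (auto simp: inj_on_def)
  then have "pre_digraph.digraph_isomorphism (with_proj H) ?f"
    unfolding pre_digraph.digraph_isomorphism_def
    using s(2) HG.wf_digraph by (auto simp: H.pverts atLeast0LessThan)
  moreover have "map_prod s s ` parcs H = parcs G"
  proof (intro equalityI subsetI)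
    fix a assume a: "a \<in> parcs G"
    obtain i' j' where "a = (i', j')" by fastforce
    moreover then have "i' \<in> s ` {0..<n}" "j' \<in> s ` {0..<n}"
      unfolding s_img using a G.arcs_less by auto
    ultimately obtain i j where "a = (s i, s j)" "i < n" "j < n" by auto
    then show "a \<in> map_prod s s ` parcs H" using a arcs by (intro image_eqI[of _ _ "(i, j)"]) auto
  qed (use H.arcs_less arcs in auto)
  then have "with_proj G = app_iso ?f (with_proj H)"
    by (simp add: app_iso_def with_proj_def H.pverts G.pverts s_img)
  ultimately show ?thesis unfolding digraph_iso_def by blast
qed

section \<open>Graphs with non-singular walk matrix\<close>

locale walk_nonsingular = graph_matrix n G for n G +
  fixes d :: int and X :: "int mat"
  assumes n_pos: "0 < n" and d_pos: "0 < d" and X: "X \<in> carrier_mat n n"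
    and WX: "W * X = d \<cdot>\<^sub>m 1\<^sub>m n" and XW: "X * W = d \<cdot>\<^sub>m 1\<^sub>m n"
begin

text \<open>\<open>X\<close> is \<open>d\<close> times the inverse of the walk matrix, so its last
  row is orthogonal to every walk vector but the last.\<close>

definition w :: "int vec" where "w = row X (n - 1)"

lemma transpose_X_mult:
  assumes "u \<in> carrier_vec n"
  shows "transpose_mat X *\<^sub>v (transpose_mat W *\<^sub>v u) = d \<cdot>\<^sub>v u"
    and "transpose_mat W *\<^sub>v (transpose_mat X *\<^sub>v u) = d \<cdot>\<^sub>v u"
proof -
  have "transpose_mat (d \<cdot>\<^sub>m 1\<^sub>m n) = d \<cdot>\<^sub>m 1\<^sub>m n" by (intro eq_matI) auto
  then have "transpose_mat X * transpose_mat W = d \<cdot>\<^sub>m 1\<^sub>m n"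
    "transpose_mat W * transpose_mat X = d \<cdot>\<^sub>m 1\<^sub>m n"
    using transpose_mult[OF W_carrier X] transpose_mult[OF X W_carrier] by (simp_all add: WX XW)
  moreover have "(d \<cdot>\<^sub>m 1\<^sub>m n) *\<^sub>v u = d \<cdot>\<^sub>v u" using assms by (intro eq_vecI) auto
  ultimately show "transpose_mat X *\<^sub>v (transpose_mat W *\<^sub>v u) = d \<cdot>\<^sub>v u"
    "transpose_mat W *\<^sub>v (transpose_mat X *\<^sub>v u) = d \<cdot>\<^sub>v u"
    using assoc_mult_mat_vec[of "transpose_mat X" n n "transpose_mat W" n u]
      assoc_mult_mat_vec[of "transpose_mat W" n n "transpose_mat X" n u] assms X W_carrier
    by simp_all
qed

sublocale cyclic_pair A n e w d
proof unfold_locales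
  show w: "w \<in> carrier_vec n" using X n_pos by (auto simp: w_def)
  show "act (monom 1 k) e \<bullet> w = (if k = n - 1 then d else 0)" if "k < n" for k
  proof -
    have "act (monom 1 k) e \<bullet> w = w \<bullet> col W k"
      using w that by (simp add: col_W comm_scalar_prod[of _ n])
    also have "\<dots> = (X * W) $$ (n - 1, k)" using X W_carrier n_pos that by (simp add: w_def)
    finally show ?thesis using n_pos that by (auto simp: XW)
  qed
  show "u = 0\<^sub>v n"
    if u: "u \<in> carrier_vec n" and z: "\<And>k. k < n \<Longrightarrow> act (monom 1 k) e \<bullet> u = 0" for u
  proof -
    have "transpose_mat W *\<^sub>v u = 0\<^sub>v n" unfolding transpose_W_mult[OF u] using z by auto
    moreover have "transpose_mat X *\<^sub>v 0\<^sub>v n = 0\<^sub>v n"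
      using X by (intro eq_vecI) (auto simp: scalar_prod_def)
    ultimately have du: "d \<cdot>\<^sub>v u = 0\<^sub>v n" using transpose_X_mult(1)[OF u] by simp
    show ?thesis
    proof (rule eq_vecI)
      fix i assume "i < dim_vec (0\<^sub>v n :: int vec)"
      then have "(d \<cdot>\<^sub>v u) $ i = 0" "i < n" using du by auto
      then show "u $ i = 0\<^sub>v n $ i" using u d_pos by simp
    qed (use u in simp)
  qed
qed (use A_sym n_pos d_pos in auto)

lemma numerator_poly_eq: "numerator_poly = walk_numerator n A"
  by (simp add: numerator_poly_def dual_poly_def walk_numerator_def horner_def)

end

locale walk_nonsingular_mod = walk_nonsingular n G d X + prime_poly_mod p
  for n G d X and p :: int +
  fixes d' :: int
  assumes d_factor: "d = p * d'" and d'_coprime: "\<not> p dvd d'"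
begin

sublocale cyclic_pair_mod A n e w d p d'
  by unfold_locales (fact d_factor d'_coprime)+

text \<open>The entries of \<open>W\<^sup>T A\<^sup>k w\<close> are values of \<open>phi\<close>,
  hence divisible by \<open>p\<close>: all \<open>A\<^sup>k w\<close> lie in the kernel of the
  transposed walk matrix modulo \<open>p\<close>, and \<open>R\<close> carries them into that of
  \<open>W\<close>. One more of them than the nullity are dependent, and the coefficients of the
  relation form \<open>P\<close>.\<close>

lemma annihilator_of_nullity:
  assumes R: "R \<in> carrier_mat n n" "R' \<in> carrier_mat n n" "K \<in> carrier_mat n n"
    and R'R: "R' * R = 1\<^sub>m n" and WR: "W * R = K * transpose_mat W"
  obtains P where "annihilates P" "Mp P \<noteq> 0" "degree_m P \<le> nullity_mod p W"
proof -
  let ?k = "nullity_mod p W"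
  define x where "x k = R *\<^sub>v act (monom 1 k) w" for k
  have x: "x k \<in> carrier_vec n" for k using R(1) by (simp add: x_def)
  have Wx: "p dvd (W *\<^sub>v x k) $ i" if i: "i < n" for i k
  proof -
    let ?y = "act (monom 1 k) w"
    have y: "?y \<in> carrier_vec n" by simp
    have "p dvd d" by (simp add: d_factor)
    define z where "z = vec n (\<lambda>j. phi (monom 1 j * monom 1 k) div p)"
    have "p dvd phi f" for f using d_dvd_phi \<open>p dvd d\<close> dvd_trans by blast
    then have "transpose_mat W *\<^sub>v ?y = p \<cdot>\<^sub>v z"
      unfolding transpose_W_mult[OF y] act_w z_def by (intro eq_vecI) auto
    moreover have "W *\<^sub>v x k = K *\<^sub>v (transpose_mat W *\<^sub>v ?y)"
      using assoc_mult_mat_vec[OF W_carrier R(1) y] W_carrier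
        assoc_mult_mat_vec[OF R(3), of "transpose_mat W" n ?y] y by (simp add: x_def WR)
    ultimately have "W *\<^sub>v x k = p \<cdot>\<^sub>v (K *\<^sub>v z)"
      using smult_mult_mat_vec[OF R(3), of z p] by (simp add: z_def)
    then show ?thesis using i R(3) by simp
  qed
  obtain a where a: "\<exists>k\<le>?k. \<not> p dvd a k" "\<And>i. i < n \<Longrightarrow> p dvd (\<Sum>k\<le>?k. a k * x k $ i)"
    by (rule kernel_mod_dependent[OF prime W_carrier, of x]) (use x Wx in auto)
  define P where "P = (\<Sum>k\<le>?k. smult (a k) (monom 1 k))"
  have coeff_P: "coeff P k = (if k \<le> ?k then a k else 0)" for k
  proof -
    have "coeff P k = (\<Sum>j\<le>?k. if j = k then a j else 0)"
      unfolding P_def coeff_sum by (intro sum.cong) simp_all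
    then show ?thesis by simp
  qed
  define z where "z = vec n (\<lambda>i. (R *\<^sub>v act P w) $ i div p)"
  have "(R *\<^sub>v act P w) $ i = (\<Sum>k\<le>?k. a k * x k $ i)" if i: "i < n" for i
  proof -
    have r: "row R i \<in> carrier_vec n" using R(1) i by auto
    have "(R *\<^sub>v act P w) $ i = act P w \<bullet> row R i"
      using R(1) i comm_scalar_prod[OF r, of "act P w"] by simp
    also have "\<dots> = (\<Sum>k\<le>?k. a k * (act (monom 1 k) w \<bullet> row R i))"
      using r by (simp add: P_def act_sum act_smult smult_scalar_prod_distrib[of _ n])
    also have "\<dots> = (\<Sum>k\<le>?k. a k * x k $ i)"
      using R(1) i comm_scalar_prod[OF r act_closed[OF w]] by (simp add: x_def)
    finally show ?thesis .
  qed
  then have "R *\<^sub>v act P w = p \<cdot>\<^sub>v z"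
    using a(2) R(1) by (intro eq_vecI) (auto simp: z_def)
  then have "R' *\<^sub>v (R *\<^sub>v act P w) = p \<cdot>\<^sub>v (R' *\<^sub>v z)"
    using smult_mult_mat_vec[OF R(2), of z p] by (simp add: z_def)
  moreover have "R' *\<^sub>v (R *\<^sub>v act P w) = act P w"
    using assoc_mult_mat_vec[OF R(2,1) act_closed[OF w]] by (simp add: R'R)
  ultimately have "annihilates P"
    unfolding annihilates_def using R(2) by (intro bexI[of _ "R' *\<^sub>v z"]) (auto simp: z_def)
  moreover have "Mp P \<noteq> 0" using a(1) coeff_P by (auto simp: eq_m_0_iff)
  moreover have "degree_m P \<le> ?k"
    using degree_m_le[of P] degree_le[of ?k P] coeff_P by force
  ultimately show ?thesis by (rule that)
qed

lemma Phi_mod_dvdm: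
  shows "monic (Phi_mod p n G)" "Phi_mod p n G dvdm \<chi>" "Phi_mod p n G dvdm numerator_poly"
proof -
  let ?\<Phi> = "Phi_mod p n G" and ?E = "walk_numerator n A"
  have "monic \<chi>" by (simp add: char_poly_degree)
  then have "Mp \<chi> \<noteq> 0" using Mp_monic(1)[of \<chi>] by auto
  note gcd = gcd_mod[OF this, of "char_poly (A + all_ones_mat n)", folded Phi_mod_def]
  then show "monic ?\<Phi>" "?\<Phi> dvdm \<chi>" by auto
  have "?\<Phi> dvdm \<chi> - (\<chi> - ?E)"
    using gcd(3) gcd(4)[unfolded char_poly_add_all_ones[OF A]] by (rule dvdm_diff)
  moreover have "\<chi> - (\<chi> - ?E) = ?E" by simp
  ultimately show "?\<Phi> dvdm numerator_poly" by (simp only: numerator_poly_eq)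
qed

lemma dvd_vec:
  assumes "R \<in> carrier_mat n n" "R' \<in> carrier_mat n n" "K \<in> carrier_mat n n"
    and "R' * R = 1\<^sub>m n" "W * R = K * transpose_mat W"
    and nullity: "odd p \<Longrightarrow> degree (sqrt_mod p (Phi_mod p n G)) = nullity_mod p W"
    and u: "u \<in> carrier_vec n" "\<And>k. k < n \<Longrightarrow> p dvd moment u k"
      "\<And>k. p ^ 2 dvd act (monom 1 k) u \<bullet> u"
    and i: "i < n"
  shows "p dvd u $ i"
proof (cases "odd p")
  case True
  obtain P where P: "annihilates P" "Mp P \<noteq> 0" "degree_m P \<le> nullity_mod p W"
    using annihilator_of_nullity[OF assms(1-5)] by blast
  show ?thesis
  proof (rule dvd_of_isotropic_sqrt[OF _ _ _ _ P(1,2) _ u i])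
    show "monic (sqrt_mod p (Phi_mod p n G))" by (rule monic_sqrt_mod)
    show "sqrt_mod p (Phi_mod p n G) dvdm g" if "Phi_mod p n G dvdm g ^ 2" for g
      using sqrt_mod_dvdm[OF Phi_mod_dvdm(1) that] .
    show "degree_m P \<le> degree (sqrt_mod p (Phi_mod p n G))" using P(3) nullity[OF True] by simp
  qed (fact Phi_mod_dvdm)+
next
  case False
  then have p2: "p = 2" using primes_dvd_imp_eq[of 2 p] prime by simp
  have "even d" by (simp add: d_factor p2)
  then have "even (act (monom 1 k) w \<bullet> w)" for k
    by (intro even_moments) (auto simp: A_diag all_ones_vec_def)
  then show ?thesis by (intro dvd_of_totally_isotropic[OF _ p2 u i]) (simp add: p2)
qed

end

lemma (in walk_nonsingular) d_dvd_vec: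
  assumes "squarefree d"
    and R: "R \<in> carrier_mat n n" "R' \<in> carrier_mat n n" "K \<in> carrier_mat n n"
      "R' * R = 1\<^sub>m n" "W * R = K * transpose_mat W"
    and nullity: "\<And>p. prime p \<Longrightarrow> odd p \<Longrightarrow> p dvd d \<Longrightarrow>
      degree (sqrt_mod p (Phi_mod p n G)) = nullity_mod p W"
    and u: "u \<in> carrier_vec n" "\<And>k. k < n \<Longrightarrow> d dvd moment u k"
      "\<And>k. d ^ 2 dvd act (monom 1 k) u \<bullet> u"
    and i: "i < n"
  shows "d dvd u $ i"
proof (rule squarefree_dvd_if_primes_dvd[OF \<open>squarefree d\<close>])
  fix p :: int assume p: "prime p" "p dvd d"
  then obtain d' where d': "d = p * d'" by (elim dvdE)
  have "\<not> p dvd d'"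
  proof
    assume "p dvd d'"
    then have "p ^ 2 dvd d" by (simp add: d' power2_eq_square)
    then have "is_unit p" by (rule squarefreeD[OF \<open>squarefree d\<close>])
    then show False using p(1) not_prime_unit by blast
  qed
  then interpret walk_nonsingular_mod n G d X p d'
    by unfold_locales (use p d' in auto)
  have "p dvd moment u k" if "k < n" for k using u(2)[OF that] p(2) dvd_trans by blast
  moreover have "p ^ 2 dvd act (monom 1 k) u \<bullet> u" for k
    using u(3)[of k] dvd_power_same[OF p(2), of 2] dvd_trans by blast
  ultimately show "p dvd u $ i" using p nullity u(1) i by (intro dvd_vec[OF R]) auto
qed

section \<open>Generalized cospectral graphs\<close>

lemma (in graph_matrix) W_mult_eq_act:
  assumes "c \<in> carrier_vec n"
  shows "W *\<^sub>v c = act (\<Sum>k<n. smult (c $ k) (monom 1 k)) e"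
proof (rule vec_eq_if_scalar_prod_eq[of _ n])
  fix x :: "int vec" assume x: "x \<in> carrier_vec n"
  have "x \<bullet> (W *\<^sub>v c) = (transpose_mat W *\<^sub>v x) \<bullet> c"
    using transpose_vec_mult_scalar[OF W_carrier assms x] by simp
  also have "\<dots> = (\<Sum>k<n. c $ k * (act (monom 1 k) e \<bullet> x))"
    using x assms by (simp add: transpose_W_mult scalar_prod_def[of "vec n _"] atLeast0LessThan mult.commute)
  also have "\<dots> = act (\<Sum>k<n. smult (c $ k) (monom 1 k)) e \<bullet> x"
    using x by (simp add: act_sum act_smult smult_scalar_prod_distrib[of _ n])
  also have "\<dots> = x \<bullet> act (\<Sum>k<n. smult (c $ k) (monom 1 k)) e"
    using x by (intro comm_scalar_prod[of _ n]) auto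
  finally show "x \<bullet> (W *\<^sub>v c) = x \<bullet> act (\<Sum>k<n. smult (c $ k) (monom 1 k)) e" .
qed (use W_carrier assms in auto)

locale cospectral_pair = G: walk_nonsingular n G d X + H: graph_matrix n H
  for n G d X H +
  assumes moments: "\<And>f. H.act f (all_ones_vec n) \<bullet> all_ones_vec n
      = G.act f (all_ones_vec n) \<bullet> all_ones_vec n"
begin

abbreviation e :: "int vec" where "e \<equiv> all_ones_vec n"

lemma act_adjoint_H:
  assumes "u \<in> carrier_vec n" "v \<in> carrier_vec n"
  shows "H.act f u \<bullet> v = u \<bullet> H.act f v"
  using assms by (rule H.act_adjoint_sym[OF H.A_sym])

text \<open>\<open>transfer\<close> is \<open>d Q\<close> for the rational orthogonal matrix \<open>Q\<close> with \<open>Q e = e\<close> that conjugates the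
  two adjacency matrices.\<close>

definition transfer :: "int vec \<Rightarrow> int vec" where
  "transfer b = transpose_mat X *\<^sub>v (transpose_mat H.W *\<^sub>v b)"

lemma transfer_closed [simp]: "b \<in> carrier_vec n \<Longrightarrow> transfer b \<in> carrier_vec n"
  using G.X H.W_carrier by (simp add: transfer_def)

lemma transfer_smult: "b \<in> carrier_vec n \<Longrightarrow> transfer (c \<cdot>\<^sub>v b) = c \<cdot>\<^sub>v transfer b"
  using G.X H.W_carrier
    smult_mult_mat_vec[of "transpose_mat H.W" n n b c]
    smult_mult_mat_vec[of "transpose_mat X" n n "transpose_mat H.W *\<^sub>v b" c]
  by (simp add: transfer_def)

text \<open>Equal walk counts give both walk matrices the same Gram matrix. Hence the definition
  through transposes, integral because of \<open>X\<close>, also sends each walk vector of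
  \<open>H\<close> to \<open>d\<close> times the one of \<open>G\<close>.\<close>

lemma transfer_act: "transfer (H.act f e) = d \<cdot>\<^sub>v G.act f e"
proof -
  have "H.act (monom 1 k) e \<bullet> H.act f e = G.act (monom 1 k) e \<bullet> G.act f e" for k
    using moments[of "f * monom 1 k"] act_adjoint_H[of "H.act (monom 1 k) e" e f]
      G.act_adjoint[of "G.act (monom 1 k) e" e f]
      comm_scalar_prod[of "H.act (monom 1 k) e" n]
    by (simp add: H.act_mult G.act_mult)
  then have "transpose_mat H.W *\<^sub>v H.act f e = transpose_mat G.W *\<^sub>v G.act f e"
    by (simp add: H.transpose_W_mult G.transpose_W_mult)
  then show ?thesis by (simp add: transfer_def G.transpose_X_mult)
qed

lemma moment_transfer:
  assumes "b \<in> carrier_vec n" "k < n"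
  shows "G.act (monom 1 k) e \<bullet> transfer b = d * (H.act (monom 1 k) e \<bullet> b)"
proof -
  have b: "transpose_mat H.W *\<^sub>v b \<in> carrier_vec n" using assms H.W_carrier by simp
  have "(transpose_mat G.W *\<^sub>v transfer b) $ k = (d \<cdot>\<^sub>v (transpose_mat H.W *\<^sub>v b)) $ k"
    unfolding transfer_def G.transpose_X_mult(2)[OF b] ..
  then show ?thesis
    using assms b by (simp add: G.transpose_W_mult H.transpose_W_mult)
qed

lemma det_H_W: "det H.W \<noteq> 0"
proof -
  have "transpose_mat H.W * H.W = transpose_mat G.W * G.W"
  proof (rule eq_matI)
    fix i j assume "i < dim_row (transpose_mat G.W * G.W)" "j < dim_col (transpose_mat G.W * G.W)"
    then have ij: "i < n" "j < n" using G.W_carrier by auto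
    have "H.act (monom 1 i) e \<bullet> H.act (monom 1 j) e = G.act (monom 1 i) e \<bullet> G.act (monom 1 j) e"
      using moments[of "monom 1 j * monom 1 i"] act_adjoint_H[of "H.act (monom 1 i) e" e "monom 1 j"]
        G.act_adjoint[of "G.act (monom 1 i) e" e "monom 1 j"]
      by (simp add: H.act_mult G.act_mult)
    then show "(transpose_mat H.W * H.W) $$ (i, j) = (transpose_mat G.W * G.W) $$ (i, j)"
      using ij G.W_carrier H.W_carrier by (simp add: G.col_W H.col_W)
  qed (use G.W_carrier H.W_carrier in auto)
  then have "det H.W * det H.W = det G.W * det G.W"
    using det_mult[of "transpose_mat H.W" n H.W] det_mult[of "transpose_mat G.W" n G.W]
      G.W_carrier H.W_carrier by (simp add: det_transpose[of _ n])
  moreover have "det G.W * det X = d ^ n"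
    using det_mult[OF G.W_carrier G.X] by (simp add: G.WX det_smult)
  ultimately show ?thesis using G.d_pos by auto
qed

lemma smult_det_eq_act:
  assumes "b \<in> carrier_vec n"
  obtains f where "det H.W \<cdot>\<^sub>v b = H.act f e"
proof
  note adj = adj_mat[OF H.W_carrier]
  have "H.W *\<^sub>v (adj_mat H.W *\<^sub>v b) = det H.W \<cdot>\<^sub>v b"
  proof -
    have "H.W *\<^sub>v (adj_mat H.W *\<^sub>v b) = (det H.W \<cdot>\<^sub>m 1\<^sub>m n) *\<^sub>v b"
      unfolding adj(2)[symmetric] by (rule assoc_mult_mat_vec[OF H.W_carrier adj(1) assms, symmetric])
    also have "\<dots> = det H.W \<cdot>\<^sub>v b" using assms by (intro eq_vecI) auto
    finally show ?thesis .
  qed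
  then show "det H.W \<cdot>\<^sub>v b = H.act (\<Sum>k<n. smult ((adj_mat H.W *\<^sub>v b) $ k) (monom 1 k)) e"
    using H.W_mult_eq_act[of "adj_mat H.W *\<^sub>v b"] adj(1) assms by simp
qed

text \<open>A nonzero multiple of every integer vector is a combination of walk vectors of
  \<open>H\<close>. On such combinations both sides are walk counts, which agree for the two graphs;
  the factor \<open>det H.W ^ 2\<close> is then cancelled.\<close>

lemma transfer_scalar_prod:
  assumes b: "b \<in> carrier_vec n" and b': "b' \<in> carrier_vec n"
  shows "G.act f (transfer b) \<bullet> transfer b' = d ^ 2 * (H.act f b \<bullet> b')"
proof -
  let ?\<delta> = "det H.W"
  obtain g where g: "?\<delta> \<cdot>\<^sub>v b = H.act g e" using smult_det_eq_act[OF b] .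
  obtain g' where g': "?\<delta> \<cdot>\<^sub>v b' = H.act g' e" using smult_det_eq_act[OF b'] .
  have "?\<delta> ^ 2 * (G.act f (transfer b) \<bullet> transfer b')
      = G.act f (transfer (?\<delta> \<cdot>\<^sub>v b)) \<bullet> transfer (?\<delta> \<cdot>\<^sub>v b')"
    using b b' by (simp add: transfer_smult G.act_vec_smult smult_scalar_prod_distrib[of _ n]
        scalar_prod_smult_distrib[of _ n] power2_eq_square)
  also have "\<dots> = d ^ 2 * (G.act f (G.act g e) \<bullet> G.act g' e)"
    by (simp add: g g' transfer_act G.act_vec_smult smult_scalar_prod_distrib[of _ n]
        scalar_prod_smult_distrib[of _ n] power2_eq_square)
  also have "G.act f (G.act g e) \<bullet> G.act g' e = H.act f (H.act g e) \<bullet> H.act g' e"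
    using moments[of "g' * (f * g)"] act_adjoint_H[of "H.act f (H.act g e)" e g']
      G.act_adjoint[of "G.act f (G.act g e)" e g']
    by (simp add: H.act_mult G.act_mult)
  also have "\<dots> = H.act f (?\<delta> \<cdot>\<^sub>v b) \<bullet> (?\<delta> \<cdot>\<^sub>v b')" by (simp only: g g')
  also have "\<dots> = ?\<delta> ^ 2 * (H.act f b \<bullet> b')"
    using b b' by (simp add: H.act_vec_smult smult_scalar_prod_distrib[of _ n]
        scalar_prod_smult_distrib[of _ n] power2_eq_square)
  finally have "?\<delta> ^ 2 * (G.act f (transfer b) \<bullet> transfer b') = ?\<delta> ^ 2 * (d ^ 2 * (H.act f b \<bullet> b'))"
    by (simp add: ac_simps)
  then show ?thesis using det_H_W by simp
qed

lemma digraph_iso_if_d_dvd: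
  assumes "\<And>i j. i < n \<Longrightarrow> j < n \<Longrightarrow> d dvd transfer (unit_vec n j) $ i"
  shows "digraph_iso (with_proj H) (with_proj G)"
proof -
  have d0: "d \<noteq> 0" using G.d_pos by simp
  define q where "q j = vec n (\<lambda>i. transfer (unit_vec n j) $ i div d)" for j
  have qc [simp]: "q j \<in> carrier_vec n" for j by (simp add: q_def)
  have dq: "transfer (unit_vec n j) = d \<cdot>\<^sub>v q j" if "j < n" for j
  proof (rule eq_vecI)
    fix i assume "i < dim_vec (d \<cdot>\<^sub>v q j)"
    then have "i < n" by (simp add: q_def)
    then show "transfer (unit_vec n j) $ i = (d \<cdot>\<^sub>v q j) $ i" using assms that by (simp add: q_def)
  qed (use carrier_vecD[OF transfer_closed[of "unit_vec n j"]] in \<open>simp add: q_def\<close>)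
  \<comment> \<open>The \<open>q j\<close> are the columns of \<open>Q\<close>. The choice
    \<open>f = 1\<close> yields their orthonormality, and \<open>f = x\<close> yields the
    conjugation of the adjacency matrices.\<close>
  have form: "G.act f (q i) \<bullet> q j = H.act f (unit_vec n i) $ j" if "i < n" "j < n" for f i j
  proof -
    have "d ^ 2 * (G.act f (q i) \<bullet> q j) = G.act f (transfer (unit_vec n i)) \<bullet> transfer (unit_vec n j)"
      using that by (simp add: dq G.act_vec_smult smult_scalar_prod_distrib[of _ n]
          scalar_prod_smult_distrib[of _ n] power2_eq_square)
    also have "\<dots> = d ^ 2 * (H.act f (unit_vec n i) \<bullet> unit_vec n j)" by (rule transfer_scalar_prod) auto
    finally show ?thesis using d0 that by simp
  qed
  have sum1: "(\<Sum>i<n. q j $ i) = 1" if j: "j < n" for j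
  proof -
    have "d * (e \<bullet> q j) = e \<bullet> transfer (unit_vec n j)"
      using j by (simp add: dq scalar_prod_smult_distrib[of _ n])
    also have "\<dots> = d * (e \<bullet> unit_vec n j)"
      using moment_transfer[of "unit_vec n j" 0] G.n_pos by (simp add: monom_0 G.act_1 H.act_1)
    finally have "e \<bullet> q j = 1" using d0 j by (simp add: all_ones_vec_def)
    then show ?thesis by (simp add: scalar_prod_def all_ones_vec_def q_def atLeast0LessThan)
  qed
  have orth: "q i \<bullet> q j = (if i = j then 1 else 0)" if "i < n" "j < n" for i j
    using form[OF that, of 1] that by (simp add: G.act_1 H.act_1 unit_vec_def)
  have "\<exists>i<n. q j = unit_vec n i" if j: "j < n" for j
  proof -
    have "(\<Sum>i<n. q j $ i * q j $ i) = 1"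
      using orth[OF j j] by (simp add: scalar_prod_def q_def atLeast0LessThan)
    then show ?thesis using unit_vec_if_sums_1[OF qc sum1[OF j]] by metis
  qed
  then obtain s where s: "\<And>j. j < n \<Longrightarrow> s j < n" "\<And>j. j < n \<Longrightarrow> q j = unit_vec n (s j)" by metis
  have inj: "inj_on s {..<n}"
  proof (rule inj_onI)
    fix i j assume ij: "i \<in> {..<n}" "j \<in> {..<n}" "s i = s j"
    then have "q i = q j" using s by simp
    then have "q i \<bullet> q j = 1" using orth[of j j] ij by simp
    then show "i = j" using orth[of i j] ij by (simp split: if_splits)
  qed
  have arcs: "(i, j) \<in> parcs H \<longleftrightarrow> (s i, s j) \<in> parcs G" if "i < n" "j < n" for i j
  proof -
    have "(G.A *\<^sub>v unit_vec n (s i)) \<bullet> unit_vec n (s j) = (H.A *\<^sub>v unit_vec n i) $ j"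
      using form[OF that, of "pCons 0 1"] that s
      by (simp add: G.act_pCons_0 G.act_1 H.act_pCons_0 H.act_1)
    then have "G.A $$ (s j, s i) = H.A $$ (j, i)" using that s by simp
    then have "(s j, s i) \<in> parcs G \<longleftrightarrow> (j, i) \<in> parcs H"
      using that s by (auto simp: adjacency_matrix_def split: if_splits)
    then show ?thesis using G.arcs_sym[of "s i" "s j"] H.arcs_sym[of i j] by simp
  qed
  show ?thesis by (rule digraph_isoI[OF G.graph_on H.graph_on s(1) inj arcs])
qed

end

theorem theorem1p6:
  fixes n :: nat and G :: "nat pair_pre_digraph" and ds :: "int list"
  assumes "graph_on n G"
    and "det (walk_matrix n G) \<noteq> 0"
    and "smith_normal_form (walk_matrix n G) ds"
    and "squarefree (last ds)"
    and "\<And>p. prime p \<Longrightarrow> odd p \<Longrightarrow> p dvd last ds \<Longrightarrow>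
           degree (sqrt_mod p (Phi_mod p n G)) = nullity_mod p (walk_matrix n G)"
  shows "DGS n G"
  unfolding DGS_def
proof (intro allI impI, elim conjE)
  fix m H assume H: "graph_on m H" and spec: "generalized_spectrum m H = generalized_spectrum n G"
  note cosp = cospectral_char_poly_eq[OF assms(1) H spec]
  have H: "graph_on n H" using H cosp(1) by simp
  interpret G: graph_matrix n G by unfold_locales fact
  interpret H: graph_matrix n H by unfold_locales fact
  show "digraph_iso (with_proj H) (with_proj G)"
  proof (cases "n = 0")
    \<comment> \<open>For \<open>n = 0\<close> the list \<open>ds\<close> is empty and
      \<open>last ds\<close> has no specified value; all graphs without vertices are
      isomorphic.\<close>
    case True
    then show ?thesis using digraph_isoI[OF assms(1) H, of id] by simp
  next
    case False
    then obtain X R R' K where d: "0 < last ds"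
      and X: "X \<in> carrier_mat n n" "G.W * X = last ds \<cdot>\<^sub>m 1\<^sub>m n" "X * G.W = last ds \<cdot>\<^sub>m 1\<^sub>m n"
      and R: "R \<in> carrier_mat n n" "R' \<in> carrier_mat n n" "K \<in> carrier_mat n n"
        "R' * R = 1\<^sub>m n" "G.W * R = K * transpose_mat G.W"
      using smith_normal_formE[OF assms(3) G.W_carrier] by blast
    interpret cospectral_pair n G "last ds" X H
    proof unfold_locales
      show "H.act f (all_ones_vec n) \<bullet> all_ones_vec n = G.act f (all_ones_vec n) \<bullet> all_ones_vec n" for f
        by (rule moments_eq[OF H.A G.A cosp(2,3)])
    qed (use False d X in auto)
    show ?thesis
    proof (rule digraph_iso_if_d_dvd, rule G.d_dvd_vec[OF assms(4) R assms(5)])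
      \<comment> \<open>The vector \<open>u\<close> is \<open>d\<close> times the image under
        \<open>Q\<close> of a unit vector. The two divisibilities express that
        \<open>Q \<int>\<^sup>n\<close> lies in \<open>M\<^sup>*\<close> and that the forms
        \<open>x\<^sup>T A\<^sup>k x\<close> are integral on it.\<close>
      fix i j assume "i < n" "j < n"
      show "last ds dvd G.act (monom 1 k) (all_ones_vec n) \<bullet> transfer (unit_vec n j)" if "k < n" for k
        using moment_transfer[of "unit_vec n j" k] that by simp
      show "(last ds) ^ 2 dvd G.act (monom 1 k) (transfer (unit_vec n j)) \<bullet> transfer (unit_vec n j)" for k
        using transfer_scalar_prod[of "unit_vec n j" "unit_vec n j"] by simp
    qed auto
  qed
qed

end
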